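(* Let $\lambda\in\mathbb R$ be irrational and let $P$ be a stationary random field on $\Omega=\Upsilon^{\mathbb Z^2}$ satisfying condition (B) and the strong $0$-$1$ law. Then for every $a\in\mathbb R$, $$\frac{1}{n+1}\,\mathcal I\big(P_{L_{\lambda,a}(\{0,\dots,n\})}\big)\xrightarrow[n\to\infty]{}\int_0^1E\big[H\big(P_0[\cdot\mid\mathcal P_{\lambda,t}](\omega)\big)\big]\,dt\qquad\text{in }L^1(P).$$
   Context: $\Upsilon$ finite, $\Omega=\Upsilon^{\mathbb Z^2}$ with product $\sigma$-algebra; $\omega_V$ restriction, $\mathcal F_V=\sigma(\omega_V)$; stationary = invariant under all shifts $(\theta_v\omega)(u)=\omega(u+v)$. $\mathcal I(P_V)(\omega)=-\log P[\omega_V]$ with $P[\omega_V]=P(\{\eta:\eta_V=\omega_V\})$. $P_0[\cdot\mid\mathcal G](\omega)$ is the conditional law of $\omega_{(0,0)}$ given $\mathcal G$; $H(\mu)=-\sum_y\mu(y)\log\mu(y)$. $L_{\lambda,a}(U)=\{(z,\lfloor\lambda z+a\rfloor):z\in U\}$ for $U\subseteq\mathbb Z$; $\mathcal P_{\lambda,t}=\mathcal F_{L_{\lambda,t}(\{-1,-2,\dots\})}$. Strong $0$-$1$ law: for every $J\subseteq\mathbb Z^2$, $\mathcal F_J=\bigcap_{V\text{ finite}}\mathcal F_{J\cup(\mathbb Z^2\setminus V)}$ mod $P$. Condition (B): there is $c_0>0$ with $P(\omega_{(0,0)}=y\mid A)>c_0$ for all $y\in\Upsilon$, $A\in\mathcal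 F_{\mathbb Z^2\setminus\{(0,0)\}}$ with $P(A)>0$. *)

theory Defs
  imports "HOL-Probability.Probability"
begin

type_synonym 'y config = "int \<times> int \<Rightarrow> 'y"

definition config_space :: "'y config measure" where
  "config_space = PiM UNIV (\<lambda>_. count_space UNIV)"

definition sigF :: "'y config measure \<Rightarrow> (int \<times> int) set \<Rightarrow> 'y config measure" where
  "sigF P V = sigma (space P) {{\<omega> \<in> space P. \<omega> v = y} | v y. v \<in> V}"

definition shift :: "int \<times> int \<Rightarrow> 'y config \<Rightarrow> 'y config" where
  "shift v \<omega> = (\<lambda>u. \<omega> (u + v))"

definition stationary :: "'y config measure \<Rightarrow> bool" where
  "stationary P \<longleftrightarrow> (\<forall>v. distr P P (shift v) = P)"

text \<open>Strong 0-1 law: F_J equals the intersection of F_{J \<union> (Z^2 - V)} over finite V, mod P.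
  The inclusion of F_J in the intersection is automatic; mod P means every set of the
  intersection differs from some set of F_J by a P-null set.\<close>
definition strong_01_law :: "'y config measure \<Rightarrow> bool" where
  "strong_01_law P \<longleftrightarrow>
     (\<forall>J A. (\<forall>V. finite V \<longrightarrow> A \<in> sets (sigF P (J \<union> (UNIV - V)))) \<longrightarrow>
        (\<exists>B \<in> sets (sigF P J). emeasure P ((A - B) \<union> (B - A)) = 0))"

definition condition_B :: "'y config measure \<Rightarrow> bool" where
  "condition_B P \<longleftrightarrow> (\<exists>c0>0. \<forall>y A. A \<in> sets (sigF P (UNIV - {(0,0)})) \<and> measure P A > 0 \<longrightarrow>
       measure P ({\<omega> \<in> space P. \<omega> (0,0) = y} \<inter> A) / measure P A > c0)"

definition info :: "'y config measure \<Rightarrow> (int \<times> int) set \<Rightarrow> 'y config \<Rightarrow> real" where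
  "info P V \<omega> = - ln (measure P {\<eta> \<in> space P. \<forall>v \<in> V. \<eta> v = \<omega> v})"

definition entropy_fn :: "('y::finite \<Rightarrow> real) \<Rightarrow> real" where
  "entropy_fn \<mu> = - (\<Sum>y\<in>UNIV. \<mu> y * ln (\<mu> y))"

definition cond_law0 :: "'y config measure \<Rightarrow> 'y config measure \<Rightarrow> 'y config \<Rightarrow> 'y \<Rightarrow> real" where
  "cond_law0 P G \<omega> y = real_cond_exp P G (indicator {\<eta> \<in> space P. \<eta> (0,0) = y}) \<omega>"

definition line :: "real \<Rightarrow> real \<Rightarrow> int set \<Rightarrow> (int \<times> int) set" where
  "line lam a U = {(z, \<lfloor>lam * of_int z + a\<rfloor>) | z. z \<in> U}"

definition past :: "'y config measure \<Rightarrow> real \<Rightarrow> real \<Rightarrow> 'y config measure" where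
  "past P lam t = sigF P (line lam t {..-1})"

end

theory Submission
  imports Defs "HOL-Analysis.Kronecker_Approximation_Theorem"
begin

text \<open>The chain rule and stationarity write the information along the line as a sum of shifted
  information gains \<open>g(W\<^sub>i) \<circ> \<theta>\<close>, where \<open>W\<^sub>i\<close> consists of the \<open>i\<close> most recent points of the discrete
  line with offset \<open>t\<^sub>i = frac (lam i + a)\<close>. Truncating \<open>W\<^sub>i\<close> to the square of radius \<open>k\<close> leaves finitely
  many patterns, each occurring for \<open>t\<close> in an interval, so that averages over \<open>i\<close> of
  functions of the pattern converge to integrals over \<open>t\<close> by equidistribution. Triviality of the
  tail (the 0-1 law for the empty set) makes the truncated gains asymptotically uncorrelated, which
  gives a weak law of large numbers. The truncation error is controlled by the gap between
  \<open>Q(L \<inter> square)\<close> and \<open>Q(L \<union> complement of square)\<close>, where \<open>L\<close> is the past half-line and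
  \<open>Q(V) = collision V\<close> is the sum over \<open>y\<close> of the squared norms of the conditional probabilities
  of \<open>y\<close> given the sigma-algebra of \<open>V\<close>; as \<open>k\<close> grows, both converge to \<open>Q(L)\<close>, the former by upward martingale convergence and the latter by downward
  convergence and the strong 0-1 law. Since condition (B) bounds conditional probabilities away from 0,
  differences of \<open>Q\<close> dominate differences of gains and of entropies.\<close>

section \<open>Equidistribution of irrational rotations\<close>

text \<open>Equidistribution applies directly only to functions of \<open>t\<close> with finitely
  many steps, whereas the entropy given the whole past is a pointwise limit of such functions, with
  no uniformity in \<open>t\<close>; the orbit might favour offsets where that limit is slow. So the
  truncation error has to be bounded by something that is itself a function of the finite pattern.
  This is why the upper set in the gap contains all sites outside the square: pattern plus exterior
  contains every possible continuation of the past, and depends on \<open>t\<close> only through the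
  pattern. The average of the gap along the orbit then converges to its integral, and only this
  integral, not a supremum over \<open>t\<close>, has to be small. Comparing a half-line with
  half-line plus exterior is also what calls for the 0-1 law for infinite \<open>J\<close>. The
  quantity \<open>Q\<close> is preferred to entropy in this comparison because its increments are
  exactly squared L2 distances between conditional probabilities, so that monotonicity, limits and
  error bounds all come from orthogonal projection.\<close>

lemma frac_add_nonneg_le:
  fixes x d :: real
  assumes "0 \<le> d"
  shows "frac (x + d) \<le> frac x + d"
  using floor_mono[of x "x + d"] assms by (simp add: frac_def)

text \<open>Each unit shift drops one nonnegative term and gains one that is at most 1.\<close>

lemma sum_translate_bounded:
  fixes f :: "nat \<Rightarrow> real"
  assumes "\<And>i. 0 \<le> f i" "\<And>i. f i \<le> 1"
  shows "(\<Sum>i\<le>n. f (i + m)) \<le> (\<Sum>i\<le>n. f i) + real m"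
proof (induction m)
  case (Suc m)
  have "(\<Sum>i\<le>n. f (Suc i + m)) + f m = (\<Sum>i\<le>Suc n. f (i + m))"
    by (subst sum.atMost_Suc_shift) simp
  then have "(\<Sum>i\<le>n. f (i + Suc m)) = (\<Sum>i\<le>n. f (i + m)) + f (Suc n + m) - f m"
    by simp
  then show ?case
    using Suc assms(1)[of m] assms(2)[of "Suc n + m"] by simp
qed simp

text \<open>By density of the multiples of \<open>lam\<close> modulo 1, the orbit started at \<open>b'\<close> is, up to finitely
  many steps, the orbit started at \<open>b\<close> moved to the right by at most \<open>\<epsilon>\<close>; and moving
  to the right by \<open>\<epsilon>\<close> raises a fractional part by at most \<open>\<epsilon>\<close>.\<close>

lemma sum_frac_le:
  fixes lam b b' \<epsilon> :: real
  assumes "lam \<notin> \<rat>" "\<epsilon> > 0"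
  shows "\<exists>K. \<forall>n. (\<Sum>i\<le>n. frac (lam * real i + b')) \<le> (\<Sum>i\<le>n. frac (lam * real i + b)) + K + \<epsilon> * real (n + 1)"
proof -
  \<comment> \<open>Aiming \<open>\<epsilon> / 2\<close> short of \<open>b' - b\<close> with
    tolerance \<open>\<epsilon> / 2\<close> places the remaining displacement \<open>d\<close> in
    \<open>[0, \<epsilon>]\<close>. The sign matters: a move to the left could wrap a fractional
    part from near 0 to near 1.\<close>
  obtain h k where k: "k > 0" "\<bar>of_int k * lam - of_int h - (b' - b - \<epsilon> / 2)\<bar> < \<epsilon> / 2"
    using sequence_of_fractional_parts_is_dense[OF assms(1) half_gt_zero[OF assms(2)]] by blast
  define m where "m = nat k"
  have m: "real m = of_int k"
    using k(1) by (simp add: m_def)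
  define d where "d = b' - (b + real m * lam - of_int h)"
  have d: "0 \<le> d" "d \<le> \<epsilon>"
    using k(2) unfolding d_def m by linarith+
  have *: "frac (lam * real i + b') \<le> frac (lam * real (i + m) + b) + \<epsilon>" for i
  proof -
    have "frac (lam * real i + b') = frac ((lam * real (i + m) + b - of_int h) + d)"
      by (simp add: d_def algebra_simps)
    also have "\<dots> \<le> frac (lam * real (i + m) + b - of_int h) + d"
      by (rule frac_add_nonneg_le[OF d(1)])
    also have "frac (lam * real (i + m) + b - of_int h) = frac (lam * real (i + m) + b)"
      by (simp add: frac_def)
    finally show ?thesis
      using d(2) by simp
  qed
  have "(\<Sum>i\<le>n. frac (lam * real i + b')) \<le> (\<Sum>i\<le>n. frac (lam * real i + b)) + real m + \<epsilon> * real (n + 1)" for n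
  proof -
    have "(\<Sum>i\<le>n. frac (lam * real i + b')) \<le> (\<Sum>i\<le>n. frac (lam * real (i + m) + b) + \<epsilon>)"
      by (intro sum_mono *)
    also have "\<dots> = (\<Sum>i\<le>n. frac (lam * real (i + m) + b)) + \<epsilon> * real (n + 1)"
      by (simp add: sum.distrib algebra_simps)
    also have "(\<Sum>i\<le>n. frac (lam * real (i + m) + b)) \<le> (\<Sum>i\<le>n. frac (lam * real i + b)) + real m"
      by (rule sum_translate_bounded[where f = "\<lambda>i. frac (lam * real i + b)"])
        (auto simp: less_imp_le[OF frac_lt_1])
    finally show ?thesis by simp
  qed
  then show ?thesis by blast
qed

text \<open>The comparison of two orbits holds in both directions, and its additive constant
  vanishes after division. Since only differences of averages are compared, the mean value of
  \<open>frac\<close> never has to be computed.\<close>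

lemma average_frac_diff_tendsto_0:
  fixes lam b b' :: real
  assumes "lam \<notin> \<rat>"
  shows "(\<lambda>n. (\<Sum>i\<le>n. frac (lam * real i + b') - frac (lam * real i + b)) / real (n + 1)) \<longlonglongrightarrow> 0"
proof (rule LIMSEQ_I)
  fix r :: real assume "r > 0"
  then have "r / 2 > 0" by simp
  from sum_frac_le[OF assms this, of b' b] obtain K1 where
    K1: "\<And>n. (\<Sum>i\<le>n. frac (lam * real i + b')) \<le> (\<Sum>i\<le>n. frac (lam * real i + b)) + K1 + r / 2 * real (n + 1)"
    by auto
  from sum_frac_le[OF assms \<open>r / 2 > 0\<close>, of b b'] obtain K2 where
    K2: "\<And>n. (\<Sum>i\<le>n. frac (lam * real i + b)) \<le> (\<Sum>i\<le>n. frac (lam * real i + b')) + K2 + r / 2 * real (n + 1)"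
    by auto
  define K where "K = max K1 K2"
  obtain N :: nat where N: "2 * K / r < real N"
    using reals_Archimedean2 by blast
  show "\<exists>N. \<forall>n\<ge>N. norm ((\<Sum>i\<le>n. frac (lam * real i + b') - frac (lam * real i + b)) / real (n + 1) - 0) < r"
  proof (intro exI allI impI)
    fix n assume "n \<ge> N"
    then have "2 * K / r < real (n + 1)" using N by simp
    then have "K < r / 2 * real (n + 1)"
      using \<open>r > 0\<close> by (simp add: field_simps)
    moreover have "\<bar>\<Sum>i\<le>n. frac (lam * real i + b') - frac (lam * real i + b)\<bar> \<le> K + r / 2 * real (n + 1)"
      using K1[of n] K2[of n] unfolding K_def sum_subtractf by linarith
    ultimately have "\<bar>\<Sum>i\<le>n. frac (lam * real i + b') - frac (lam * real i + b)\<bar> < r * real (n + 1)"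
      by simp
    then show "norm ((\<Sum>i\<le>n. frac (lam * real i + b') - frac (lam * real i + b)) / real (n + 1) - 0) < r"
      by (simp add: field_simps abs_divide)
  qed
qed

text \<open>As a function of \<open>frac x\<close>, \<open>frac (x - e)\<close> has slope 1 and a
  single drop by 1, at \<open>e\<close>. In the difference for \<open>d\<close> and \<open>c\<close>
  the slopes cancel and the two jumps leave the interval. Counting visits thus becomes comparing two
  orbits.\<close>

lemma indicator_frac_interval:
  fixes x c d :: real
  assumes "0 \<le> c" "c \<le> d" "d \<le> 1"
  shows "indicator {c..<d} (frac x) = (d - c) + (frac (x - d) - frac (x - c))"
proof -
  have *: "frac (x - e) = (if e \<le> frac x then frac x - e else frac x - e + 1)" if "0 \<le> e" "e \<le> 1" for e :: real
  proof -
    have "\<lfloor>x - e\<rfloor> = (if e \<le> frac x then \<lfloor>x\<rfloor> else \<lfloor>x\<rfloor> - 1)"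
      using that floor_correct[of x] unfolding floor_eq_iff frac_def by (auto; linarith)
    then show ?thesis by (simp add: frac_def)
  qed
  show ?thesis
    using assms *[of c] *[of d] by (auto simp: indicator_def)
qed

lemma equidistributed_interval:
  fixes lam a c d :: real
  assumes "lam \<notin> \<rat>" "0 \<le> c" "c \<le> d" "d \<le> 1"
  shows "(\<lambda>n. (\<Sum>i\<le>n. indicator {c..<d} (frac (lam * real i + a))) / real (n + 1)) \<longlonglongrightarrow> d - c"
proof -
  have "(\<lambda>n. (d - c) + (\<Sum>i\<le>n. frac (lam * real i + (a - d)) - frac (lam * real i + (a - c))) / real (n + 1))
      \<longlonglongrightarrow> (d - c) + 0"
    by (intro tendsto_add tendsto_const average_frac_diff_tendsto_0 assms)
  moreover have "(\<Sum>i\<le>n. indicator {c..<d} (frac (lam * real i + a))) / real (n + 1)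
    = (d - c) + (\<Sum>i\<le>n. frac (lam * real i + (a - d)) - frac (lam * real i + (a - c))) / real (n + 1)" for n
    unfolding indicator_frac_interval[OF assms(2-4)] sum.distrib
    by (simp add: field_simps)
  ultimately show ?thesis by simp
qed

text \<open>The hypothesis on \<open>f\<close> says that its value depends only on which breakpoints
  have been passed. Hence \<open>f\<close> is a finite combination of indicators of half-open
  intervals, indexed by the set \<open>S\<close> of breakpoints passed.\<close>

lemma equidistributed_step:
  fixes lam a :: real and f :: "real \<Rightarrow> real"
  assumes "lam \<notin> \<rat>" "finite C"
    and f: "\<And>s t. 0 \<le> s \<Longrightarrow> s < 1 \<Longrightarrow> 0 \<le> t \<Longrightarrow> t < 1 \<Longrightarrow> {c \<in> C. c \<le> s} = {c \<in> C. c \<le> t} \<Longrightarrow> f s = f t"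
    and [measurable]: "f \<in> borel_measurable borel"
  shows "(\<lambda>n. (\<Sum>i\<le>n. f (frac (lam * real i + a))) / real (n + 1)) \<longlonglongrightarrow> (LBINT t:{0..1}. f t)"
proof -
  \<comment> \<open>The offsets with pattern \<open>S\<close> start at the last point of
    \<open>S\<close> and end before the first point of \<open>C - S\<close>; 0 and 1 serve when one
    of these sets is empty. The \<open>max\<close> in \<open>hi\<close> makes the interval empty
    when \<open>S\<close> is not an initial segment of \<open>C\<close>.\<close>
  define lo where "lo S = Max (insert 0 S)" for S :: "real set"
  define hi where "hi S = max (lo S) (Min (insert 1 (C - S)))" for S :: "real set"
  \<comment> \<open>For a pattern that no offset realises this value is arbitrary, but it is
    multiplied by the indicator of an empty interval.\<close>
  define g where "g S = f (SOME t. 0 \<le> t \<and> t < 1 \<and> {c \<in> C. c \<le> t} = S)" for S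
  have eq: "t \<in> {lo S..<hi S} \<longleftrightarrow> {c \<in> C. c \<le> t} = S" if "S \<subseteq> C" "0 \<le> t" "t < 1" for S t
  proof -
    have "finite S" using that(1) assms(2) finite_subset by blast
    then have "lo S \<le> t \<longleftrightarrow> (\<forall>c\<in>S. c \<le> t)"
      using that by (simp add: lo_def)
    moreover have "t < Min (insert 1 (C - S)) \<longleftrightarrow> (\<forall>c\<in>C - S. t < c)"
      using that assms(2) by simp
    ultimately have "t \<in> {lo S..<hi S} \<longleftrightarrow> (\<forall>c\<in>S. c \<le> t) \<and> (\<forall>c\<in>C - S. t < c)"
      by (auto simp: hi_def less_max_iff_disj)
    also have "\<dots> \<longleftrightarrow> {c \<in> C. c \<le> t} = S"
      using that(1) by (auto simp: not_le) (metis DiffI not_le)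
    finally show ?thesis .
  qed
  have lohi: "0 \<le> lo S" "lo S \<le> hi S" if "S \<subseteq> C" for S
    using finite_subset[OF that assms(2)] by (auto simp: lo_def hi_def)
  \<comment> \<open>\<open>C\<close> may have points beyond 1, so the endpoints are clipped to the
    unit interval, where the counting result for intervals applies.\<close>
  define hi' where "hi' S = max (min 1 (lo S)) (min 1 (hi S))" for S
  define lo' where "lo' S = min 1 (lo S)" for S
  have eq': "t \<in> {lo' S..<hi' S} \<longleftrightarrow> {c \<in> C. c \<le> t} = S" if "S \<subseteq> C" "0 \<le> t" "t < 1" for S t
    using eq[OF that] that by (auto simp: lo'_def hi'_def)
  have lohi': "0 \<le> lo' S" "lo' S \<le> hi' S" "hi' S \<le> 1" if "S \<subseteq> C" for S
    using lohi[OF that] by (auto simp: lo'_def hi'_def)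
  have fin: "finite (Pow C)" using assms(2) by simp
  have fsum: "f t = (\<Sum>S\<in>Pow C. g S * indicator {lo' S..<hi' S} t)" if t: "0 \<le> t" "t < 1" for t
  proof -
    let ?S = "{c \<in> C. c \<le> t}"
    have "(\<Sum>S\<in>Pow C. g S * indicator {lo' S..<hi' S} t) = (\<Sum>S\<in>Pow C. if S = ?S then g S else 0)"
      by (intro sum.cong refl) (auto simp: indicator_def eq'[OF _ t, simplified])
    also have "\<dots> = g ?S"
      using fin by (simp add: sum.delta)
    also have "\<dots> = f t"
    proof -
      let ?Q = "\<lambda>s. 0 \<le> s \<and> s < 1 \<and> {c \<in> C. c \<le> s} = ?S"
      have ex: "?Q t" using t by blast
      have "?Q (SOME s. ?Q s)" by (rule someI[of ?Q, OF ex])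
      then have "f (SOME s. ?Q s) = f t" using t by (intro f) auto
      then show ?thesis by (simp add: g_def)
    qed
    finally show ?thesis by simp
  qed
  have "(LBINT t:{0..1}. f t) = (\<integral>t. (\<Sum>S\<in>Pow C. g S * indicator {lo' S..<hi' S} t) \<partial>lborel)"
    unfolding set_lebesgue_integral_def
  proof (rule integral_cong_AE)
    have z: "indicator {lo' S..<hi' S} t = (0::real)" if "t \<notin> {0..<1}" "S \<subseteq> C" for t S
      using lohi'[OF that(2)] that(1) by (auto simp: indicator_def)
    \<comment> \<open>The behaviour of \<open>f\<close> is controlled on \<open>[0, 1)\<close> only;
      the endpoint 1 is a null set.\<close>
    show "AE t in lborel. indicator {0..1} t *\<^sub>R f t = (\<Sum>S\<in>Pow C. g S * indicator {lo' S..<hi' S} t)"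
      using AE_lborel_singleton[of 1]
    proof eventually_elim
      case (elim t)
      show ?case
      proof (cases "t \<in> {0..<1}")
        case True
        then show ?thesis using fsum[of t] by simp
      next
        case False
        then have "t \<notin> {0..1}" using elim by auto
        moreover have "(\<Sum>S\<in>Pow C. g S * indicator {lo' S..<hi' S} t) = 0"
          using z[OF False] by (intro sum.neutral) auto
        ultimately show ?thesis by simp
      qed
    qed
  qed auto
  also have "\<dots> = (\<Sum>S\<in>Pow C. g S * (hi' S - lo' S))"
    using lohi' by (subst Bochner_Integration.integral_sum) (auto simp: measure_lborel_Ico emeasure_lborel_Ico)
  finally have int: "(LBINT t:{0..1}. f t) = (\<Sum>S\<in>Pow C. g S * (hi' S - lo' S))" .
  have "(\<lambda>n. \<Sum>S\<in>Pow C. g S * ((\<Sum>i\<le>n. indicator {lo' S..<hi' S} (frac (lam * real i + a))) / real (n + 1)))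
     \<longlonglongrightarrow> (\<Sum>S\<in>Pow C. g S * (hi' S - lo' S))"
    using lohi' by (intro tendsto_sum tendsto_mult tendsto_const equidistributed_interval assms(1)) auto
  moreover have "(\<Sum>i\<le>n. f (frac (lam * real i + a))) / real (n + 1)
     = (\<Sum>S\<in>Pow C. g S * ((\<Sum>i\<le>n. indicator {lo' S..<hi' S} (frac (lam * real i + a))) / real (n + 1)))" for n
  proof -
    have "(\<Sum>i\<le>n. f (frac (lam * real i + a)))
        = (\<Sum>i\<le>n. \<Sum>S\<in>Pow C. g S * indicator {lo' S..<hi' S} (frac (lam * real i + a)))"
      by (intro sum.cong refl fsum) (auto simp: frac_lt_1)
    also have "\<dots> = (\<Sum>S\<in>Pow C. g S * (\<Sum>i\<le>n. indicator {lo' S..<hi' S} (frac (lam * real i + a))))"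
      by (subst sum.swap) (simp add: sum_distrib_left)
    finally show ?thesis unfolding sum_divide_distrib[of _ "Pow C"] by (simp only: times_divide_eq_right sum_divide_distrib[of _ "Pow C"])
  qed
  ultimately show ?thesis unfolding int by simp
qed

text \<open>The carry to the next integer occurs once \<open>t\<close> reaches
  \<open>1 - frac x\<close>. These thresholds become the breakpoints at which a truncated line
  changes its pattern.\<close>

lemma floor_add_less_1:
  fixes x t :: real
  assumes "0 \<le> t" "t < 1"
  shows "\<lfloor>x + t\<rfloor> = \<lfloor>x\<rfloor> + (if 1 - frac x \<le> t then 1 else 0)"
  using assms floor_correct[of x] unfolding floor_eq_iff frac_def by (auto; linarith)

section \<open>Conditional expectations along monotone families of sigma-algebras\<close>

lemma subalgebra_trans: "subalgebra M G \<Longrightarrow> subalgebra G F \<Longrightarrow> subalgebra M F"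
  by (auto simp: subalgebra_def)

text \<open>Valid for divergent sequences too, because both sides are then the same unspecified
  value. Pointwise limits can therefore be rewritten everywhere, without an exceptional null set
  spoiling measurability.\<close>

lemma lim_ignore_initial_segment: "lim (\<lambda>n. X (n + k)) = lim X" for X :: "nat \<Rightarrow> 'a::t2_space"
  unfolding lim_def by (metis LIMSEQ_ignore_initial_segment LIMSEQ_offset)

context prob_space
begin

text \<open>This is nonnegativity of the variance of \<open>\<bar>X\<bar>\<close>.\<close>

lemma expectation_abs_le_sqrt:
  fixes X :: "'a \<Rightarrow> real"
  assumes "integrable M X" "integrable M (\<lambda>x. (X x)\<^sup>2)"
  shows "expectation (\<lambda>x. \<bar>X x\<bar>) \<le> sqrt (expectation (\<lambda>x. (X x)\<^sup>2))"
proof -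
  have "variance (\<lambda>x. \<bar>X x\<bar>) = expectation (\<lambda>x. (X x)\<^sup>2) - (expectation (\<lambda>x. \<bar>X x\<bar>))\<^sup>2"
    using assms by (subst variance_eq) auto
  then have "(expectation (\<lambda>x. \<bar>X x\<bar>))\<^sup>2 \<le> expectation (\<lambda>x. (X x)\<^sup>2)"
    using variance_positive[of "\<lambda>x. \<bar>X x\<bar>"] by simp
  then show ?thesis
    by (simp add: real_le_rsqrt)
qed

lemma sigma_finite_subalgebraI: "subalgebra M F \<Longrightarrow> sigma_finite_subalgebra M F"
  by (intro finite_measure_subalgebra_is_sigma_finite finite_measure_subalgebra.intro
      finite_measure_subalgebra_axioms.intro) unfold_locales

lemma cond_exp_measurable:
  assumes "subalgebra M F"
  shows "real_cond_exp M F f \<in> borel_measurable F" "real_cond_exp M F f \<in> borel_measurable M"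
  using measurable_from_subalg[OF assms] by auto

lemma integrable_bounded:
  fixes f :: "'a \<Rightarrow> real"
  assumes "f \<in> borel_measurable M" "\<And>x. \<bar>f x\<bar> \<le> B"
  shows "integrable M f"
  using assms by (intro integrable_const_bound[where B = B]) auto

lemma cond_exp_bounded:
  fixes f :: "'a \<Rightarrow> real"
  assumes "subalgebra M F" "f \<in> borel_measurable M" "\<And>x. \<bar>f x\<bar> \<le> B"
  shows "AE x in M. \<bar>real_cond_exp M F f x\<bar> \<le> B"
proof -
  interpret sigma_finite_subalgebra M F by (rule sigma_finite_subalgebraI[OF assms(1)])
  have i: "integrable M f" by (rule integrable_bounded[OF assms(2,3)])
  have "AE x in M. real_cond_exp M F f x \<le> B"
    using assms(3) by (intro real_cond_exp_le_c[OF i]) (auto simp: abs_le_iff)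
  moreover have "AE x in M. real_cond_exp M F f x \<ge> -B"
    using assms(3) by (intro real_cond_exp_ge_c[OF i]) (auto simp: abs_le_iff intro!: AE_I2, meson minus_le_iff)
  ultimately show ?thesis
    by eventually_elim auto
qed

lemma integrable_cond_exp_mult:
  fixes f g :: "'a \<Rightarrow> real"
  assumes "subalgebra M F" "f \<in> borel_measurable M" "\<And>x. \<bar>f x\<bar> \<le> B"
    and "g \<in> borel_measurable M" "AE x in M. \<bar>g x\<bar> \<le> C"
  shows "integrable M (\<lambda>x. g x * real_cond_exp M F f x)"
proof (rule integrable_const_bound[where B = "C * B"])
  show "AE x in M. norm (g x * real_cond_exp M F f x) \<le> C * B"
    using cond_exp_bounded[OF assms(1-3)] assms(5)
    by eventually_elim (auto simp: abs_mult intro!: mult_mono intro: order_trans[OF abs_ge_zero])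
qed (use assms cond_exp_measurable[OF assms(1)] in auto)

text \<open>By orthogonality, the squared norm of the difference of two nested conditional expectations is
  the difference of these quantities. Along a monotone family they converge, so the conditional
  expectations are Cauchy; this replaces martingale convergence.\<close>

definition cond_sq :: "'a measure \<Rightarrow> ('a \<Rightarrow> real) \<Rightarrow> real" where
  "cond_sq F f = expectation (\<lambda>x. (real_cond_exp M F f x)\<^sup>2)"

lemma integrable_cond_exp_sq:
  fixes f :: "'a \<Rightarrow> real"
  assumes "subalgebra M F" "f \<in> borel_measurable M" "\<And>x. \<bar>f x\<bar> \<le> B"
  shows "integrable M (\<lambda>x. (real_cond_exp M F f x)\<^sup>2)"
  unfolding power2_eq_square
  by (rule integrable_cond_exp_mult[OF assms cond_exp_measurable(2)[OF assms(1)] cond_exp_bounded[OF assms]])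

lemma cond_exp_diff_sq:
  fixes f :: "'a \<Rightarrow> real"
  assumes "subalgebra M G" "subalgebra G F" "f \<in> borel_measurable M" "\<And>x. \<bar>f x\<bar> \<le> B"
  shows "expectation (\<lambda>x. (real_cond_exp M G f x - real_cond_exp M F f x)\<^sup>2) = cond_sq G f - cond_sq F f"
    and "integrable M (\<lambda>x. (real_cond_exp M G f x - real_cond_exp M F f x)\<^sup>2)"
proof -
  have MF: "subalgebra M F" using assms subalgebra_trans by blast
  interpret F: sigma_finite_subalgebra M F by (rule sigma_finite_subalgebraI[OF MF])
  interpret G: sigma_finite_subalgebra M G by (rule sigma_finite_subalgebraI[OF assms(1)])
  let ?F = "real_cond_exp M F f" and ?G = "real_cond_exp M G f"
  note [measurable] = assms(3)
  note Fb = cond_exp_bounded[OF MF assms(3,4)]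
  have i: "integrable M (\<lambda>x. ?F x * f x)"
  proof (rule integrable_const_bound[where B = "B * B"])
    show "AE x in M. norm (?F x * f x) \<le> B * B"
      using Fb by eventually_elim (auto simp: abs_mult intro!: mult_mono assms(4) intro: order_trans[OF abs_ge_zero])
  qed (use MF cond_exp_measurable in auto)
  \<comment> \<open>\<open>?F\<close> is measurable for both sigma-algebras and can be pulled out of
    either conditional expectation. The cross term therefore equals the squared norm of
    \<open>?F\<close>, which is Pythagoras for nested projections.\<close>
  have 1: "expectation (\<lambda>x. ?F x * ?G x) = expectation (\<lambda>x. ?F x * f x)"
    by (intro G.real_cond_exp_intg(2) i measurable_from_subalg[OF assms(2)] cond_exp_measurable(1)[OF MF]) simp
  have 2: "expectation (\<lambda>x. ?F x * ?F x) = expectation (\<lambda>x. ?F x * f x)"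
    by (intro F.real_cond_exp_intg(2) i cond_exp_measurable(1)[OF MF]) simp
  have iFG: "integrable M (\<lambda>x. ?F x * ?G x)"
    by (intro integrable_cond_exp_mult[OF assms(1,3,4) cond_exp_measurable(2)[OF MF] Fb])
  note iF = integrable_cond_exp_sq[OF MF assms(3,4)]
  note iG = integrable_cond_exp_sq[OF assms(1,3,4)]
  have eq: "(?G x - ?F x)\<^sup>2 = (?G x)\<^sup>2 - 2 * (?F x * ?G x) + (?F x)\<^sup>2" for x
    by (simp add: power2_eq_square algebra_simps)
  show "integrable M (\<lambda>x. (?G x - ?F x)\<^sup>2)"
    unfolding eq using iF iG iFG by auto
  show "expectation (\<lambda>x. (?G x - ?F x)\<^sup>2) = cond_sq G f - cond_sq F f"
    unfolding eq using iF iG iFG 1 2 by (simp add: cond_sq_def power2_eq_square)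
qed

lemma cond_sq_mono:
  fixes f :: "'a \<Rightarrow> real"
  assumes "subalgebra M G" "subalgebra G F" "f \<in> borel_measurable M" "\<And>x. \<bar>f x\<bar> \<le> B"
  shows "cond_sq F f \<le> cond_sq G f"
proof -
  have "0 \<le> expectation (\<lambda>x. (real_cond_exp M G f x - real_cond_exp M F f x)\<^sup>2)"
    by (intro Bochner_Integration.integral_nonneg) simp
  then show ?thesis
    using cond_exp_diff_sq(1)[OF assms] by simp
qed

lemma integrable_cond_exp:
  fixes f :: "'a \<Rightarrow> real"
  assumes "subalgebra M F" "f \<in> borel_measurable M" "\<And>x. \<bar>f x\<bar> \<le> B"
  shows "integrable M (real_cond_exp M F f)"
  using cond_exp_bounded[OF assms] cond_exp_measurable(2)[OF assms(1)]
  by (intro integrable_const_bound[where B = B]) auto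

lemma cond_exp_diff_abs:
  fixes f :: "'a \<Rightarrow> real"
  assumes "subalgebra M G" "subalgebra G F" "f \<in> borel_measurable M" "\<And>x. \<bar>f x\<bar> \<le> B"
  shows "expectation (\<lambda>x. \<bar>real_cond_exp M G f x - real_cond_exp M F f x\<bar>) \<le> sqrt (cond_sq G f - cond_sq F f)"
proof -
  have MF: "subalgebra M F" using assms subalgebra_trans by blast
  show ?thesis
    using expectation_abs_le_sqrt[of "\<lambda>x. real_cond_exp M G f x - real_cond_exp M F f x"]
      cond_exp_diff_sq[OF assms] integrable_cond_exp[OF MF assms(3,4)] integrable_cond_exp[OF assms(1,3,4)]
    by auto
qed

lemma cond_sq_bounds:
  fixes f :: "'a \<Rightarrow> real"
  assumes "subalgebra M F" "f \<in> borel_measurable M" "\<And>x. \<bar>f x\<bar> \<le> B"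
  shows "0 \<le> cond_sq F f" "cond_sq F f \<le> B\<^sup>2"
proof -
  show "0 \<le> cond_sq F f" unfolding cond_sq_def by simp
  have "cond_sq F f \<le> expectation (\<lambda>x. B\<^sup>2)"
    unfolding cond_sq_def
  proof (rule integral_mono_AE)
    show "AE x in M. (real_cond_exp M F f x)\<^sup>2 \<le> B\<^sup>2"
      using cond_exp_bounded[OF assms] by eventually_elim (metis abs_ge_zero power2_abs power_mono)
  qed (use integrable_cond_exp_sq[OF assms] in auto)
  then show "cond_sq F f \<le> B\<^sup>2" by (simp add: prob_space)
qed

lemma cond_sq_monoseq_convergent:
  fixes f :: "'a \<Rightarrow> real"
  assumes sub: "\<And>n. subalgebra M (G n)"
    and chain: "(\<forall>i j. i \<le> j \<longrightarrow> subalgebra (G i) (G j)) \<or> (\<forall>i j. i \<le> j \<longrightarrow> subalgebra (G j) (G i))"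
    and f: "f \<in> borel_measurable M" "\<And>x. \<bar>f x\<bar> \<le> B"
  shows "convergent (\<lambda>n. cond_sq (G n) f)"
proof (rule Bseq_monoseq_convergent)
  show "Bseq (\<lambda>n. cond_sq (G n) f)"
    using cond_sq_bounds[OF sub f] by (intro BseqI'[where K = "B\<^sup>2"]) auto
  show "monoseq (\<lambda>n. cond_sq (G n) f)"
    using chain unfolding monoseq_def by (meson cond_sq_mono[OF sub _ f])
qed

text \<open>The disjunction \<open>chain\<close> treats decreasing families (first case) and
  increasing ones (second case) together. A Cauchy sequence in L1 has a subsequence converging
  almost everywhere; passing to it is harmless, since the squared norms converge along the full
  sequence by monotonicity.\<close>

lemma cond_exp_chain_AE_subseq:
  fixes f :: "'a \<Rightarrow> real"
  assumes sub: "\<And>n. subalgebra M (G n)"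
    and chain: "(\<forall>i j. i \<le> j \<longrightarrow> subalgebra (G i) (G j)) \<or> (\<forall>i j. i \<le> j \<longrightarrow> subalgebra (G j) (G i))"
    and f: "f \<in> borel_measurable M" "\<And>x. \<bar>f x\<bar> \<le> B"
  obtains r :: "nat \<Rightarrow> nat" where "strict_mono r"
    "AE x in M. (\<lambda>i. real_cond_exp M (G (r i)) f x) \<longlonglongrightarrow> lim (\<lambda>i. real_cond_exp M (G (r i)) f x)"
proof -
  let ?N = "\<lambda>n. cond_sq (G n) f"
  have d: "expectation (\<lambda>x. norm (real_cond_exp M (G i) f x - real_cond_exp M (G j) f x)) \<le> sqrt \<bar>?N i - ?N j\<bar>" for i j
  proof -
    consider "subalgebra (G i) (G j)" | "subalgebra (G j) (G i)"
      using chain by (meson nat_le_linear)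
    then show ?thesis
    proof cases
      case 1
      then show ?thesis
        using cond_exp_diff_abs[OF sub 1 f] by (auto intro: order_trans)
    next
      case 2
      then show ?thesis
        using cond_exp_diff_abs[OF sub 2 f]
        by (subst norm_minus_commute, subst abs_minus_commute) (auto intro: order_trans)
    qed
  qed
  have "Cauchy ?N"
    using cond_sq_monoseq_convergent[OF sub chain f] by (simp add: Cauchy_convergent_iff)
  have "\<exists>N. \<forall>i\<ge>N. \<forall>j\<ge>N. expectation (\<lambda>x. norm (real_cond_exp M (G i) f x - real_cond_exp M (G j) f x)) < e" if "e > 0" for e
  proof -
    have "e\<^sup>2 > 0" using that by simp
    then obtain N where N: "\<And>i j. i \<ge> N \<Longrightarrow> j \<ge> N \<Longrightarrow> norm (?N i - ?N j) < e\<^sup>2"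
      using \<open>Cauchy ?N\<close> unfolding Cauchy_iff by meson
    have "expectation (\<lambda>x. norm (real_cond_exp M (G i) f x - real_cond_exp M (G j) f x)) < e"
      if "i \<ge> N" "j \<ge> N" for i j
    proof -
      have "sqrt \<bar>?N i - ?N j\<bar> < e"
        using N[OF that] \<open>e > 0\<close> by (intro real_less_lsqrt) auto
      then show ?thesis using d[of i j] by linarith
    qed
    then show ?thesis by blast
  qed
  from cauchy_L1_AE_cauchy_subseq[OF integrable_cond_exp[OF sub f] this] obtain r where
    r: "strict_mono r" "AE x in M. Cauchy (\<lambda>i. real_cond_exp M (G (r i)) f x)"
    by metis
  from r(2) have "AE x in M. (\<lambda>i. real_cond_exp M (G (r i)) f x) \<longlonglongrightarrow> lim (\<lambda>i. real_cond_exp M (G (r i)) f x)"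
    by eventually_elim (simp add: Cauchy_convergent_iff convergent_LIMSEQ_iff)
  then show thesis using r(1) that by blast
qed

text \<open>The bound \<open>B\<close> on \<open>f\<close> passes to all conditional expectations,
  so dominated convergence applies. The integrals over \<open>A\<close> serve to recognise
  \<open>p\<close> as a conditional expectation, the squares to transfer its norm.\<close>

lemma cond_exp_lim_properties:
  fixes f :: "'a \<Rightarrow> real"
  assumes sub: "\<And>n. subalgebra M (G n)"
    and f: "f \<in> borel_measurable M" "\<And>x. \<bar>f x\<bar> \<le> B"
    and lim: "AE x in M. (\<lambda>i. real_cond_exp M (G i) f x) \<longlonglongrightarrow> p x"
    and p[measurable]: "p \<in> borel_measurable M"
  shows "integrable M p"
    and "A \<in> sets M \<Longrightarrow> (\<lambda>i. \<integral>x\<in>A. real_cond_exp M (G i) f x \<partial>M) \<longlonglongrightarrow> (\<integral>x\<in>A. p x \<partial>M)"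
    and "(\<lambda>i. cond_sq (G i) f) \<longlonglongrightarrow> expectation (\<lambda>x. (p x)\<^sup>2)"
proof -
  note [measurable] = cond_exp_measurable(2)[OF sub]
  have b: "AE x in M. \<forall>i. \<bar>real_cond_exp M (G i) f x\<bar> \<le> B"
    using cond_exp_bounded[OF sub f] by (simp add: AE_all_countable)
  have pb: "AE x in M. norm (p x) \<le> B"
    using lim b
  proof eventually_elim
    case (elim x)
    have "(\<lambda>i. \<bar>real_cond_exp M (G i) f x\<bar>) \<longlonglongrightarrow> \<bar>p x\<bar>"
      using elim(1) by (rule tendsto_rabs)
    then show ?case
      using LIMSEQ_le_const2[of _ "\<bar>p x\<bar>" B] elim(2) by auto
  qed
  then show "integrable M p"
    by (intro integrable_const_bound[where B = B]) auto
  show "(\<lambda>i. \<integral>x\<in>A. real_cond_exp M (G i) f x \<partial>M) \<longlonglongrightarrow> (\<integral>x\<in>A. p x \<partial>M)" if [measurable]: "A \<in> sets M"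
    unfolding set_lebesgue_integral_def
  proof (rule integral_dominated_convergence[where w = "\<lambda>_. B"])
    show "AE x in M. (\<lambda>i. indicator A x *\<^sub>R real_cond_exp M (G i) f x) \<longlonglongrightarrow> indicator A x *\<^sub>R p x"
      using lim by eventually_elim (intro tendsto_intros)
    show "AE x in M. norm (indicator A x *\<^sub>R real_cond_exp M (G i) f x) \<le> B" for i
      using b by eventually_elim (auto simp: indicator_def intro: order_trans[OF abs_ge_zero])
  qed auto
  show "(\<lambda>i. cond_sq (G i) f) \<longlonglongrightarrow> expectation (\<lambda>x. (p x)\<^sup>2)"
    unfolding cond_sq_def
  proof (rule integral_dominated_convergence[where w = "\<lambda>_. B\<^sup>2"])
    show "AE x in M. (\<lambda>i. (real_cond_exp M (G i) f x)\<^sup>2) \<longlonglongrightarrow> (p x)\<^sup>2"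
      using lim by eventually_elim (intro tendsto_intros)
    show "AE x in M. norm ((real_cond_exp M (G i) f x)\<^sup>2) \<le> B\<^sup>2" for i
      using b by eventually_elim (simp, metis abs_ge_zero power2_abs power_mono)
  qed auto
qed

lemma cond_sq_tendsto_of_subseq:
  fixes f :: "'a \<Rightarrow> real"
  assumes sub: "\<And>n. subalgebra M (G n)"
    and chain: "(\<forall>i j. i \<le> j \<longrightarrow> subalgebra (G i) (G j)) \<or> (\<forall>i j. i \<le> j \<longrightarrow> subalgebra (G j) (G i))"
    and f: "f \<in> borel_measurable M" "\<And>x. \<bar>f x\<bar> \<le> B"
    and r: "strict_mono r" "(\<lambda>i. cond_sq (G (r i)) f) \<longlonglongrightarrow> l"
  shows "(\<lambda>i. cond_sq (G i) f) \<longlonglongrightarrow> l"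
proof -
  obtain l' where l': "(\<lambda>i. cond_sq (G i) f) \<longlonglongrightarrow> l'"
    using cond_sq_monoseq_convergent[OF sub chain f] by (auto simp: convergent_def)
  then have "(\<lambda>i. cond_sq (G (r i)) f) \<longlonglongrightarrow> l'"
    using LIMSEQ_subseq_LIMSEQ[OF l' r(1)] by (simp add: o_def)
  then show ?thesis
    using l' r(2) LIMSEQ_unique by blast
qed

lemma cond_sq_cong_AE:
  assumes "subalgebra M F" "p \<in> borel_measurable M" "AE x in M. real_cond_exp M F f x = p x"
  shows "cond_sq F f = expectation (\<lambda>x. (p x)\<^sup>2)"
  unfolding cond_sq_def using assms(2,3) cond_exp_measurable(2)[OF assms(1)]
  by (intro integral_cong_AE) auto

text \<open>A form of Levy's upward theorem: the limit \<open>p\<close> is measurable for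
  \<open>F\<close> and has the same integrals as \<open>f\<close> over the sets of every
  \<open>G n\<close>, hence over all sets of \<open>F\<close>.\<close>

lemma cond_sq_increasing_tendsto:
  fixes f :: "'a \<Rightarrow> real"
  assumes F: "subalgebra M F" and GF: "\<And>n. subalgebra F (G n)"
    and inc: "\<And>i j. i \<le> j \<Longrightarrow> subalgebra (G j) (G i)"
    and gen: "sets F = sigma_sets (space M) (\<Union>n. sets (G n))"
    and f: "f \<in> borel_measurable M" "\<And>x. \<bar>f x\<bar> \<le> B"
  shows "(\<lambda>n. cond_sq (G n) f) \<longlonglongrightarrow> cond_sq F f"
proof -
  have sub: "subalgebra M (G n)" for n
    using F GF subalgebra_trans by blast
  interpret F: sigma_finite_subalgebra M F by (rule sigma_finite_subalgebraI[OF F])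
  have chain: "(\<forall>i j. i \<le> j \<longrightarrow> subalgebra (G i) (G j)) \<or> (\<forall>i j. i \<le> j \<longrightarrow> subalgebra (G j) (G i))"
    using inc by blast
  obtain r :: "nat \<Rightarrow> nat" where r: "strict_mono r"
    "AE x in M. (\<lambda>i. real_cond_exp M (G (r i)) f x) \<longlonglongrightarrow> lim (\<lambda>i. real_cond_exp M (G (r i)) f x)"
    by (rule cond_exp_chain_AE_subseq[OF sub chain f])
  define p where "p = (\<lambda>x. lim (\<lambda>i. real_cond_exp M (G (r i)) f x))"
  have pF: "p \<in> borel_measurable F"
    unfolding p_def
    by (rule borel_measurable_lim_metric, rule measurable_from_subalg[OF GF], rule cond_exp_measurable(1)[OF sub])
  then have pM[measurable]: "p \<in> borel_measurable M"
    by (rule measurable_from_subalg[OF F])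
  have rp: "AE x in M. (\<lambda>i. real_cond_exp M (G (r i)) f x) \<longlonglongrightarrow> p x"
    using r(2) by (simp add: p_def)
  note props = cond_exp_lim_properties[of "\<lambda>i. G (r i)", OF sub f rp pM]
  have fi: "integrable M f" by (rule integrable_bounded[OF f])
  \<comment> \<open>Once \<open>r i\<close> has passed \<open>n\<close>, the set \<open>A\<close>
    belongs to \<open>G (r i)\<close> and the integral over it no longer changes.\<close>
  have basic: "(\<integral>x\<in>A. f x \<partial>M) = (\<integral>x\<in>A. p x \<partial>M)" if A: "A \<in> sets (G n)" for A n
  proof -
    have AM: "A \<in> sets M" using A sub[of n] by (auto simp: subalgebra_def)
    have "(\<integral>x\<in>A. real_cond_exp M (G (r i)) f x \<partial>M) = (\<integral>x\<in>A. f x \<partial>M)" if "i \<ge> n" for i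
    proof -
      interpret sigma_finite_subalgebra M "G (r i)" by (rule sigma_finite_subalgebraI[OF sub])
      have "n \<le> r i" using that seq_suble[OF r(1), of i] by linarith
      then have "A \<in> sets (G (r i))" using A inc unfolding subalgebra_def by blast
      then show ?thesis by (rule real_cond_exp_intA[OF fi, symmetric])
    qed
    then have "(\<lambda>i. \<integral>x\<in>A. real_cond_exp M (G (r i)) f x \<partial>M) \<longlonglongrightarrow> (\<integral>x\<in>A. f x \<partial>M)"
      by (intro tendsto_eventually) (auto simp: eventually_sequentially)
    then show ?thesis
      using props(2)[OF AM] LIMSEQ_unique by blast
  qed
  have all: "(\<integral>x\<in>A. f x \<partial>M) = (\<integral>x\<in>A. p x \<partial>M)" if "A \<in> sets F" for A
  proof -
    have G: "(\<Union>n. sets (G n)) \<subseteq> Pow (space M)"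
      using sub sets.sets_into_space unfolding subalgebra_def by blast
    \<comment> \<open>The union of the \<open>G n\<close> need not be a sigma-algebra, but it is
      closed under intersections, so Dynkin's lemma extends the identity to what it
      generates.\<close>
    have Int: "Int_stable (\<Union>n. sets (G n))"
    proof (rule Int_stableI)
      fix a b assume "a \<in> (\<Union>n. sets (G n))" "b \<in> (\<Union>n. sets (G n))"
      then obtain i j where "a \<in> sets (G i)" "b \<in> sets (G j)" by auto
      then have "a \<in> sets (G (max i j))" "b \<in> sets (G (max i j))"
        using inc[of i "max i j"] inc[of j "max i j"] unfolding subalgebra_def by auto
      then show "a \<inter> b \<in> (\<Union>n. sets (G n))" by blast
    qed
    have "A \<in> sigma_sets (space M) (\<Union>n. sets (G n))" using that gen by simp
    with Int G show ?thesis
    proof (induction rule: sigma_sets_induct_disjoint)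
      case (basic A)
      then show ?case using \<open>\<And>A n. A \<in> sets (G n) \<Longrightarrow> (\<integral>x\<in>A. f x \<partial>M) = (\<integral>x\<in>A. p x \<partial>M)\<close> by blast
    next
      case empty
      then show ?case by (simp add: set_lebesgue_integral_def)
    next
      case (compl A)
      then have A: "A \<in> sets M" using F gen unfolding subalgebra_def by blast
      have *: "(\<integral>x\<in>space M - A. g x \<partial>M) = (\<integral>x\<in>space M. g x \<partial>M) - (\<integral>x\<in>A. g x \<partial>M)"
        if "integrable M g" for g :: "'a \<Rightarrow> real"
      proof -
        have "(\<integral>x\<in>A \<union> (space M - A). g x \<partial>M) = (\<integral>x\<in>A. g x \<partial>M) + (\<integral>x\<in>space M - A. g x \<partial>M)"
          using A that
          by (intro set_integral_Un) (auto simp: set_integrable_def simp del: real_scaleR_def intro!: integrable_mult_indicator)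
        moreover have "A \<union> (space M - A) = space M" using sets.sets_into_space[OF A] by auto
        ultimately show ?thesis by simp
      qed
      have "space M \<in> sets (G 0)" using sub[of 0] unfolding subalgebra_def by (metis sets.top)
      from basic[OF this] show ?case
        using compl *[OF fi] *[OF props(1)] by simp
    next
      case (union A)
      then have A: "\<And>i. A i \<in> sets M" using F gen unfolding subalgebra_def by blast
      have d: "A i \<inter> A j = {}" if "i \<noteq> j" for i j
        using union(1) that by (auto simp: disjoint_family_on_def)
      have s: "set_integrable M (\<Union>i. A i) g" if "integrable M g" for g :: "'a \<Rightarrow> real"
        using A that by (auto simp: set_integrable_def simp del: real_scaleR_def intro!: integrable_mult_indicator)
      show ?case
        using lebesgue_integral_countable_add[OF A d s[OF fi]]
          lebesgue_integral_countable_add[OF A d s[OF props(1)]] union(3) by simp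
    qed
  qed
  have "AE x in M. real_cond_exp M F f x = p x"
    by (rule F.real_cond_exp_charact[OF all fi props(1) pF])
  then have "cond_sq F f = expectation (\<lambda>x. (p x)\<^sup>2)"
    by (rule cond_sq_cong_AE[OF F pM])
  then show ?thesis
    using cond_sq_tendsto_of_subseq[OF sub chain f r(1) props(3)] by simp
qed

text \<open>The limit is first identified as the conditional expectation given the intersection
  \<open>H\<close> of the family. The hypothesis \<open>tail\<close> says that \<open>H\<close> and
  \<open>F\<close> have the same sets up to null sets, so conditioning on either gives the same
  function almost everywhere.\<close>

lemma cond_sq_decreasing_tendsto:
  fixes f :: "'a \<Rightarrow> real"
  assumes sub: "\<And>n. subalgebra M (G n)" and FG: "\<And>n. subalgebra (G n) F"
    and dec: "\<And>i j. i \<le> j \<Longrightarrow> subalgebra (G i) (G j)"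
    and tail: "\<And>A. (\<And>n. A \<in> sets (G n)) \<Longrightarrow> \<exists>B\<in>sets F. emeasure M ((A - B) \<union> (B - A)) = 0"
    and f: "f \<in> borel_measurable M" "\<And>x. \<bar>f x\<bar> \<le> B"
  shows "(\<lambda>n. cond_sq (G n) f) \<longlonglongrightarrow> cond_sq F f"
proof -
  have F: "subalgebra M F"
    using sub FG subalgebra_trans by blast
  define H where "H = sigma (space M) (\<Inter>n. sets (G n))"
  have "sigma_algebra (space M) (\<Inter>n. sets (G n))"
  proof -
    have "sigma_algebra (space M) (sets (G n))" for n
      using sub[of n] sets.sigma_algebra_axioms[of "G n"] by (simp add: subalgebra_def)
    then show ?thesis
      unfolding sigma_algebra_iff2 by (simp add: image_subset_iff) blast
  qed
  then have sH: "sets H = (\<Inter>n. sets (G n))"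
    unfolding H_def by (simp add: sigma_algebra.sets_measure_of_eq)
  have spH: "space H = space M" by (simp add: H_def space_measure_of_conv)
  have GH: "subalgebra (G n) H" for n
    using sH spH sub[of n] by (auto simp: subalgebra_def)
  have H: "subalgebra M H"
    using sub GH subalgebra_trans by blast
  have HF: "subalgebra H F"
    using FG sH spH F by (auto simp: subalgebra_def)
  interpret F: sigma_finite_subalgebra M F by (rule sigma_finite_subalgebraI[OF F])
  interpret H: sigma_finite_subalgebra M H by (rule sigma_finite_subalgebraI[OF H])
  have chain: "(\<forall>i j. i \<le> j \<longrightarrow> subalgebra (G i) (G j)) \<or> (\<forall>i j. i \<le> j \<longrightarrow> subalgebra (G j) (G i))"
    using dec by blast
  obtain r :: "nat \<Rightarrow> nat" where r: "strict_mono r"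
    "AE x in M. (\<lambda>i. real_cond_exp M (G (r i)) f x) \<longlonglongrightarrow> lim (\<lambda>i. real_cond_exp M (G (r i)) f x)"
    by (rule cond_exp_chain_AE_subseq[OF sub chain f])
  define p where "p = (\<lambda>x. lim (\<lambda>i. real_cond_exp M (G (r i)) f x))"
  have pG: "p \<in> borel_measurable (G n)" for n
  proof -
    \<comment> \<open>The first terms are measurable only for larger sigma-algebras. Dropping
      \<open>n\<close> of them leaves a sequence of \<open>G n\<close>-measurable functions with the
      same limit.\<close>
    have "p = (\<lambda>x. lim (\<lambda>i. real_cond_exp M (G (r (i + n))) f x))"
      unfolding p_def using lim_ignore_initial_segment[of "\<lambda>i. real_cond_exp M (G (r i)) f x" n for x] by simp
    moreover have "real_cond_exp M (G (r (i + n))) f \<in> borel_measurable (G n)" for i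
    proof (rule measurable_from_subalg[OF dec cond_exp_measurable(1)[OF sub]])
      show "n \<le> r (i + n)"
        using seq_suble[OF r(1), of "i + n"] by linarith
    qed
    ultimately show ?thesis
      using borel_measurable_lim_metric[of "\<lambda>i. real_cond_exp M (G (r (i + n))) f"] by simp
  qed
  have pH: "p \<in> borel_measurable H"
  proof (rule measurableI)
    fix A :: "real set" assume "A \<in> sets borel"
    then have "p -` A \<inter> space (G n) \<in> sets (G n)" for n
      using pG measurable_sets by blast
    then show "p -` A \<inter> space H \<in> sets H"
      using sub unfolding sH spH subalgebra_def by auto
  qed simp
  then have pM[measurable]: "p \<in> borel_measurable M"
    by (rule measurable_from_subalg[OF H])
  have rp: "AE x in M. (\<lambda>i. real_cond_exp M (G (r i)) f x) \<longlonglongrightarrow> p x"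
    using r(2) by (simp add: p_def)
  note props = cond_exp_lim_properties[of "\<lambda>i. G (r i)", OF sub f rp pM]
  have fi: "integrable M f" by (rule integrable_bounded[OF f])
  have "(\<integral>x\<in>A. f x \<partial>M) = (\<integral>x\<in>A. p x \<partial>M)" if A: "A \<in> sets H" for A
  proof -
    have AM: "A \<in> sets M" using A H by (auto simp: subalgebra_def)
    have "(\<integral>x\<in>A. real_cond_exp M (G (r i)) f x \<partial>M) = (\<integral>x\<in>A. f x \<partial>M)" for i
    proof -
      interpret sigma_finite_subalgebra M "G (r i)" by (rule sigma_finite_subalgebraI[OF sub])
      show ?thesis using A sH by (intro real_cond_exp_intA[OF fi, symmetric]) auto
    qed
    then show ?thesis
      using props(2)[OF AM] by (simp add: LIMSEQ_const_iff)
  qed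
  then have 1: "AE x in M. real_cond_exp M H f x = p x"
    by (rule H.real_cond_exp_charact[OF _ fi props(1) pH])
  have 2: "AE x in M. real_cond_exp M H f x = real_cond_exp M F f x"
  proof (rule H.real_cond_exp_charact[OF _ fi])
    show "integrable M (real_cond_exp M F f)" by (rule integrable_cond_exp[OF F f])
    show "real_cond_exp M F f \<in> borel_measurable H"
      by (rule measurable_from_subalg[OF HF cond_exp_measurable(1)[OF F]])
    fix A assume A: "A \<in> sets H"
    then obtain D where D: "D \<in> sets F" "emeasure M ((A - D) \<union> (D - A)) = 0"
      using tail[of A] sH by auto
    have [measurable]: "A \<in> sets M" "D \<in> sets M"
      using A D H F by (auto simp: subalgebra_def)
    have "(A - D) \<union> (D - A) \<in> null_sets M"
      using D(2) by (intro null_setsI) auto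
    from AE_not_in[OF this] have AD: "AE x in M. x \<in> A \<longleftrightarrow> x \<in> D"
      by eventually_elim auto
    have eq: "(\<integral>x\<in>A. g x \<partial>M) = (\<integral>x\<in>D. g x \<partial>M)" if [measurable]: "g \<in> borel_measurable M" for g :: "'a \<Rightarrow> real"
      unfolding set_lebesgue_integral_def
      by (rule integral_cong_AE) (use AD in \<open>auto simp: indicator_def\<close>)
    show "(\<integral>x\<in>A. f x \<partial>M) = (\<integral>x\<in>A. real_cond_exp M F f x \<partial>M)"
      using F.real_cond_exp_intA[OF fi D(1)] eq[OF f(1)] eq[OF cond_exp_measurable(2)[OF F]] by simp
  qed
  have "AE x in M. real_cond_exp M F f x = p x"
    using 1 2 by eventually_elim simp
  then have "cond_sq F f = expectation (\<lambda>x. (p x)\<^sup>2)"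
    by (rule cond_sq_cong_AE[OF F pM])
  then show ?thesis
    using cond_sq_tendsto_of_subseq[OF sub chain f r(1) props(3)] by simp
qed

end

section \<open>Cylinder probabilities\<close>

lemma abs_ln_diff_le:
  fixes a b c :: real
  assumes "0 < c" "c \<le> a" "c \<le> b"
  shows "\<bar>ln a - ln b\<bar> \<le> \<bar>a - b\<bar> / c"
proof -
  have *: "ln x - ln y \<le> (x - y) / c" if "c \<le> y" "y \<le> x" for x y
  proof -
    have "ln x - ln y = ln (x / y)" using that assms(1) by (simp add: ln_div)
    also have "\<dots> \<le> x / y - 1" using that assms(1) by (intro ln_le_minus_one) simp
    also have "\<dots> = (x - y) / y" using that assms(1) by (simp add: field_simps)
    also have "\<dots> \<le> (x - y) / c" using that assms(1) by (intro divide_left_mono) auto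
    finally show ?thesis .
  qed
  have mono: "ln y \<le> ln x" if "c \<le> y" "y \<le> x" for x y
    using that assms(1) by simp
  show ?thesis
    using *[of b a] *[of a b] mono[of b a] mono[of a b] assms
    by (cases "a \<le> b") (auto simp: abs_if)
qed

text \<open>One \<open>1 / c\<close> bounds \<open>\<bar>ln a\<bar>\<close>, via
  \<open>ln (1 / a) \<le> 1 / a - 1\<close>; the other is the Lipschitz constant of
  \<open>ln\<close> to the right of \<open>c\<close>.\<close>

lemma abs_mult_ln_diff_le:
  fixes a b c :: real
  assumes "0 < c" "c \<le> a" "c \<le> b" "a \<le> 1" "b \<le> 1"
  shows "\<bar>a * ln a - b * ln b\<bar> \<le> 2 / c * \<bar>a - b\<bar>"
proof -
  have "a * ln a - b * ln b = (a - b) * ln a + b * (ln a - ln b)"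
    by (simp add: algebra_simps)
  then have "\<bar>a * ln a - b * ln b\<bar> \<le> \<bar>a - b\<bar> * \<bar>ln a\<bar> + \<bar>b\<bar> * \<bar>ln a - ln b\<bar>"
    by (metis abs_mult abs_triangle_ineq)
  also have "\<dots> \<le> \<bar>a - b\<bar> * (1 / c) + 1 * (\<bar>a - b\<bar> / c)"
  proof (intro add_mono mult_mono abs_ln_diff_le)
    have "\<bar>ln a\<bar> = ln (1 / a)" using assms by (simp add: ln_div)
    also have "\<dots> \<le> 1 / a - 1" using assms by (intro ln_le_minus_one) simp
    also have "\<dots> \<le> 1 / c" using assms frac_le[of 1 1 c a] by linarith
    finally show "\<bar>ln a\<bar> \<le> 1 / c" .
  qed (use assms in auto)
  finally show ?thesis by simp
qed

lemma abs_mult_ln_le: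
  fixes x c :: real
  assumes "0 < c" "c \<le> x" "x \<le> 1"
  shows "\<bar>x * ln x\<bar> \<le> 2 / c"
proof -
  have "\<bar>x * ln x\<bar> \<le> 2 / c * \<bar>x - 1\<bar>"
    using abs_mult_ln_diff_le[of c x 1] assms by simp
  also have "\<dots> \<le> 2 / c * 1" using assms by (intro mult_left_mono) auto
  finally show ?thesis by simp
qed

lemma abs_indicator_le_1: "\<bar>indicator A x :: real\<bar> \<le> 1"
  by (simp add: indicator_def)

section \<open>Cylinders and squares\<close>

definition cyl :: "(int \<times> int) set \<Rightarrow> 'y config \<Rightarrow> 'y config set" where
  "cyl V \<omega> = {\<eta>. \<forall>v\<in>V. \<eta> v = \<omega> v}"

lemma mem_cyl_self [simp]: "\<omega> \<in> cyl V \<omega>"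
  by (simp add: cyl_def)

lemma cyl_eq_iff: "\<omega> \<in> cyl V \<eta> \<longleftrightarrow> cyl V \<eta> = cyl V \<omega>"
proof
  assume "\<omega> \<in> cyl V \<eta>"
  then have "\<omega> v = \<eta> v" if "v \<in> V" for v
    using that by (simp add: cyl_def)
  then show "cyl V \<eta> = cyl V \<omega>"
    by (simp add: cyl_def)
qed simp

lemma finite_range_cyl:
  fixes V :: "(int \<times> int) set"
  assumes "finite V"
  shows "finite (range (cyl V :: ('y::finite) config \<Rightarrow> _))"
proof -
  have eq: "cyl V \<omega> = cyl V (restrict \<omega> V)" for \<omega> :: "'y config"
    by (auto simp: cyl_def)
  have "cyl V \<omega> \<in> cyl V ` (PiE V (\<lambda>_. UNIV))" for \<omega> :: "'y config"
    by (rule image_eqI[where x = "restrict \<omega> V"], rule eq) simp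
  then have "range (cyl V :: 'y config \<Rightarrow> _) \<subseteq> cyl V ` (PiE V (\<lambda>_. UNIV))"
    by (rule image_subsetI)
  moreover have "finite (PiE V (\<lambda>_. UNIV :: 'y set))"
    using assms by (intro finite_PiE) auto
  ultimately show ?thesis
    by (rule finite_surj[rotated])
qed

definition origin_is :: "'y \<Rightarrow> 'y config set" where
  "origin_is y = {\<eta>. \<eta> (0, 0) = y}"

definition square :: "nat \<Rightarrow> (int \<times> int) set" where
  "square k = {- int k..int k} \<times> {- int k..int k}"

lemma finite_square [simp]: "finite (square k)"
  by (simp add: square_def)

lemma square_mono: "i \<le> j \<Longrightarrow> square i \<subseteq> square j"
  by (auto simp: square_def)

lemma finite_subset_square:
  assumes "finite V"
  shows "\<exists>k. V \<subseteq> square k"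
  using assms
proof (induction V)
  case (insert v V)
  then obtain k where k: "V \<subseteq> square k" by blast
  obtain x y where v: "v = (x, y)" by (cases v)
  let ?m = "max k (nat (max \<bar>x\<bar> \<bar>y\<bar>))"
  have "v \<in> square ?m" by (auto simp: v square_def)
  moreover have "V \<subseteq> square ?m" using k square_mono[of k ?m] by auto
  ultimately show ?case by blast
qed auto

locale random_field = prob_space P for P :: "('y::finite) config measure" +
  fixes c0 :: real
  assumes sets_P: "sets P = sets config_space"
    and stationary_P: "stationary P"
    and c0_pos: "0 < c0"
    and cond_B: "\<And>y A. A \<in> sets (sigF P (UNIV - {(0, 0)})) \<Longrightarrow> 0 < measure P A \<Longrightarrow>
      c0 < measure P ({\<omega> \<in> space P. \<omega> (0, 0) = y} \<inter> A) / measure P A"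
    and strong_law: "strong_01_law P"
begin

lemma space_P [simp]: "space P = UNIV"
  using sets_eq_imp_space_eq[OF sets_P] by (auto simp: config_space_def space_PiM)

lemma prob_UNIV [simp]: "prob UNIV = 1"
  using prob_space by simp

lemma coord_sets: "{\<omega>. \<omega> v = y} \<in> sets P"
proof -
  have "(\<lambda>\<omega>. \<omega> v) -` {y} \<inter> space config_space \<in> sets (config_space :: 'y config measure)"
    unfolding config_space_def by (intro measurable_sets[OF measurable_component_singleton]) auto
  moreover have "space (config_space :: 'y config measure) = UNIV"
    by (auto simp: config_space_def space_PiM)
  ultimately show ?thesis
    unfolding sets_P by (simp add: vimage_def)
qed

lemma sets_sigF: "sets (sigF P V) = sigma_sets UNIV {{\<omega>. \<omega> v = y} | v y. v \<in> V}"
  unfolding sigF_def by (subst sets_measure_of) auto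

lemma space_sigF [simp]: "space (sigF P V) = UNIV"
  by (simp add: sigF_def space_measure_of_conv)

lemma sigF_subalgebra: "subalgebra P (sigF P V)"
proof -
  have "sets (sigF P V) \<subseteq> sets P"
    unfolding sets_sigF using coord_sets by (intro sets.sigma_sets_subset[of _ P, simplified]) auto
  then show ?thesis by (simp add: subalgebra_def)
qed

lemma sigF_sets_P: "A \<in> sets (sigF P V) \<Longrightarrow> A \<in> sets P"
  using sigF_subalgebra by (auto simp: subalgebra_def)

lemma sigF_mono: "V \<subseteq> W \<Longrightarrow> subalgebra (sigF P W) (sigF P V)"
  unfolding subalgebra_def sets_sigF by (simp, rule sigma_sets_mono') blast

lemma coord_sigF: "v \<in> V \<Longrightarrow> {\<omega>. \<omega> v = y} \<in> sets (sigF P V)"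
  unfolding sets_sigF by (rule sigma_sets.Basic) blast

text \<open>The property survives complements and countable unions. It makes the cylinders over a
  finite \<open>V\<close> atoms, and functions measurable for the empty set of sites
  constant.\<close>

lemma sigF_determined:
  assumes "A \<in> sets (sigF P V)" "\<And>v. v \<in> V \<Longrightarrow> \<eta> v = \<omega> v"
  shows "\<eta> \<in> A \<longleftrightarrow> \<omega> \<in> A"
  using assms(1) unfolding sets_sigF
  by (induction rule: sigma_sets.induct) (auto simp: assms(2))

lemma cyl_sigF: "finite V \<Longrightarrow> cyl V \<omega> \<in> sets (sigF P V)"
proof -
  assume "finite V"
  have "cyl V \<omega> = (\<Inter>v\<in>V. {\<eta>. \<eta> v = \<omega> v}) \<inter> space (sigF P V)"
    by (auto simp: cyl_def)
  also have "\<dots> \<in> sets (sigF P V)"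
  proof (cases "V = {}")
    case False
    then have "(\<Inter>v\<in>V. {\<eta>. \<eta> v = \<omega> v}) \<in> sets (sigF P V)"
      using \<open>finite V\<close> coord_sigF by (intro sets.finite_INT) auto
    then show ?thesis using sets.top[of "sigF P V"] by (intro sets.Int) simp_all
  qed (use sets.top[of "sigF P V"] in simp)
  finally show ?thesis .
qed

lemma cyl_sets: "finite V \<Longrightarrow> cyl V \<omega> \<in> sets P"
  by (rule sigF_sets_P[OF cyl_sigF])

text \<open>A preimage is the union of the cylinders of its points, and a finite \<open>V\<close>
  over a finite alphabet has only finitely many cylinders.\<close>

lemma local_measurable:
  fixes f :: "'y config \<Rightarrow> real"
  assumes "finite V" "\<And>\<omega> \<eta>. (\<And>v. v \<in> V \<Longrightarrow> \<eta> v = \<omega> v) \<Longrightarrow> f \<eta> = f \<omega>"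
  shows "f \<in> borel_measurable (sigF P V)"
proof (rule measurableI)
  fix A :: "real set"
  have "f -` A = \<Union>(cyl V ` (f -` A))"
  proof
    show "\<Union>(cyl V ` (f -` A)) \<subseteq> f -` A"
    proof
      fix \<eta> assume "\<eta> \<in> \<Union>(cyl V ` (f -` A))"
      then obtain \<omega> where "f \<omega> \<in> A" "\<eta> \<in> cyl V \<omega>" by auto
      then show "\<eta> \<in> f -` A" using assms(2)[of \<eta> \<omega>] by (auto simp: cyl_def)
    qed
  qed (use mem_cyl_self in blast)
  moreover have "\<Union>(cyl V ` (f -` A)) \<in> sets (sigF P V)"
    using finite_range_cyl[OF assms(1)] cyl_sigF[OF assms(1)]
    by (intro sets.finite_Union) (auto intro: finite_subset[OF _ finite_range_cyl[OF assms(1)]])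
  ultimately show "f -` A \<inter> space (sigF P V) \<in> sets (sigF P V)" by simp
qed simp

lemma info_cyl: "info P V \<omega> = - ln (prob (cyl V \<omega>))"
  by (simp add: info_def cyl_def)

lemma shift_measurable [measurable]: "shift v \<in> measurable P P"
proof -
  have "shift v \<in> measurable (config_space :: 'y config measure) config_space"
    unfolding config_space_def shift_def
    by (intro measurable_PiM_single') (auto simp: PiE_iff intro: measurable_component_singleton)
  then show ?thesis using measurable_cong_sets[OF sets_P sets_P] by simp
qed

lemma distr_shift: "distr P P (shift v) = P"
  using stationary_P unfolding stationary_def by blast

lemma expectation_shift:
  fixes f :: "'y config \<Rightarrow> real"
  assumes "f \<in> borel_measurable P"
  shows "expectation (\<lambda>\<omega>. f (shift v \<omega>)) = expectation f"
  using integral_distr[OF shift_measurable assms, of v] by (simp add: distr_shift)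

lemma prob_cyl_shift:
  assumes "finite V"
  shows "prob (cyl ((\<lambda>u. u + x) ` V) \<omega>) = prob (cyl V (shift x \<omega>))"
proof -
  have "prob (cyl V (shift x \<omega>)) = measure (distr P P (shift x)) (cyl V (shift x \<omega>))"
    by (simp add: distr_shift)
  also have "\<dots> = prob (shift x -` cyl V (shift x \<omega>) \<inter> space P)"
    by (rule measure_distr[OF shift_measurable cyl_sets[OF assms]])
  also have "shift x -` cyl V (shift x \<omega>) \<inter> space P = cyl ((\<lambda>u. u + x) ` V) \<omega>"
    by (auto simp: cyl_def shift_def)
  finally show ?thesis by simp
qed

lemma info_shift: "finite V \<Longrightarrow> info P ((\<lambda>u. u + x) ` V) \<omega> = info P V (shift x \<omega>)"
  by (simp add: info_cyl prob_cyl_shift)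

lemma cyl_insert_origin: "cyl (insert (0, 0) V) \<omega> = origin_is (\<omega> (0, 0)) \<inter> cyl V \<omega>"
  unfolding cyl_def origin_is_def by blast

lemma origin_is_sets [measurable]: "origin_is y \<in> sets P"
  unfolding origin_is_def by (rule coord_sets)

lemma cond_B':
  assumes "A \<in> sets (sigF P V)" "(0, 0) \<notin> V" "0 < prob A"
  shows "c0 * prob A < prob (origin_is y \<inter> A)"
proof -
  have "A \<in> sets (sigF P (UNIV - {(0, 0)}))"
    using assms(1) sigF_mono[of V "UNIV - {(0, 0)}"] assms(2) by (auto simp: subalgebra_def)
  from cond_B[OF this assms(3), of y] show ?thesis
    using assms(3) by (simp add: origin_is_def field_simps)
qed

text \<open>Sites are added one at a time: translating the new site to the origin, condition (B)
  shows that it costs at most a factor \<open>c0\<close>. Elementary conditional probabilities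
  therefore make sense at every configuration.\<close>

lemma prob_cyl_pos:
  assumes "finite V"
  shows "0 < prob (cyl V \<omega>)"
  using assms
proof (induction V)
  case empty
  have "cyl {} \<omega> = space P" by (simp add: cyl_def)
  then show ?case using prob_space by simp
next
  case (insert v V)
  let ?V = "(\<lambda>u. u + (- v)) ` V"
  have eq: "insert v V = (\<lambda>u. u + v) ` insert (0, 0) ?V"
    by (simp add: image_image zero_prod_def[symmetric])
  have fin: "finite ?V" using insert by simp
  have "prob (cyl V \<omega>) = prob (cyl ((\<lambda>u. u + v) ` ?V) \<omega>)" by (simp add: image_image)
  then have pos: "0 < prob (cyl ?V (shift v \<omega>))"
    using insert.IH prob_cyl_shift[OF fin] by simp
  have "prob (cyl (insert v V) \<omega>) = prob (cyl (insert (0, 0) ?V) (shift v \<omega>))"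
    unfolding eq by (intro prob_cyl_shift) (use fin in simp)
  also have "\<dots> > c0 * prob (cyl ?V (shift v \<omega>))"
    unfolding cyl_insert_origin using insert pos fin
    by (intro cond_B'[OF cyl_sigF]) (auto simp: zero_prod_def[symmetric])
  finally show ?case using pos c0_pos by (meson less_trans mult_pos_pos)
qed

definition origin_prob :: "(int \<times> int) set \<Rightarrow> 'y \<Rightarrow> 'y config \<Rightarrow> real" where
  "origin_prob V y \<omega> = prob (origin_is y \<inter> cyl V \<omega>) / prob (cyl V \<omega>)"

lemma origin_prob_bounds:
  assumes "finite V" "(0, 0) \<notin> V"
  shows "c0 \<le> origin_prob V y \<omega>" "origin_prob V y \<omega> \<le> 1"
proof -
  have pos: "0 < prob (cyl V \<omega>)" by (rule prob_cyl_pos[OF assms(1)])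
  show "c0 \<le> origin_prob V y \<omega>"
    using cond_B'[OF cyl_sigF[OF assms(1)] assms(2) pos, of y] pos by (simp add: origin_prob_def field_simps)
  have "prob (origin_is y \<inter> cyl V \<omega>) \<le> prob (cyl V \<omega>)"
    by (rule finite_measure_mono[OF _ cyl_sets[OF assms(1)]]) simp
  then show "origin_prob V y \<omega> \<le> 1"
    using pos by (simp add: origin_prob_def)
qed

lemma origin_prob_measurable:
  assumes "finite V"
  shows "origin_prob V y \<in> borel_measurable (sigF P V)"
proof (rule local_measurable[OF assms])
  fix \<omega> \<eta> :: "'y config" assume "\<And>v. v \<in> V \<Longrightarrow> \<eta> v = \<omega> v"
  then have "cyl V \<eta> = cyl V \<omega>" by (auto simp: cyl_def)
  then show "origin_prob V y \<eta> = origin_prob V y \<omega>" by (simp add: origin_prob_def)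
qed

lemma set_integral_sum_cyl:
  fixes g :: "'y config \<Rightarrow> real"
  assumes "finite V" "A \<in> sets (sigF P V)" "integrable P g"
  shows "(\<integral>\<omega>\<in>A. g \<omega> \<partial>P) = (\<Sum>c\<in>{c \<in> range (cyl V). c \<subseteq> A}. \<integral>\<omega>\<in>c. g \<omega> \<partial>P)"
proof -
  let ?C = "{c \<in> range (cyl V). c \<subseteq> A}"
  have fin: "finite ?C" by (rule finite_subset[OF _ finite_range_cyl[OF assms(1)]]) blast
  have "indicator A \<omega> = (\<Sum>c\<in>?C. indicator c \<omega> :: real)" for \<omega>
  proof -
    have "(\<Sum>c\<in>?C. indicator c \<omega> :: real) = (\<Sum>c\<in>?C. if c = cyl V \<omega> then 1 else 0)"
    proof (rule sum.cong[OF refl])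
      fix c assume "c \<in> ?C"
      then obtain \<eta> where "c = cyl V \<eta>" by auto
      then show "indicator c \<omega> = (if c = cyl V \<omega> then 1 else 0 :: real)"
        using cyl_eq_iff[of \<omega> V \<eta>] by (simp add: indicator_def)
    qed
    also have "\<dots> = (if cyl V \<omega> \<subseteq> A then 1 else 0)" using fin by (simp add: sum.delta)
    also have "cyl V \<omega> \<subseteq> A \<longleftrightarrow> \<omega> \<in> A"
    proof
      assume "\<omega> \<in> A"
      then have "\<eta> \<in> A" if "\<eta> \<in> cyl V \<omega>" for \<eta>
        using sigF_determined[OF assms(2), of \<eta> \<omega>] that by (simp add: cyl_def)
      then show "cyl V \<omega> \<subseteq> A" by blast
    qed (use mem_cyl_self in blast)
    finally show ?thesis by (simp add: indicator_def)
  qed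
  then have "(\<integral>\<omega>\<in>A. g \<omega> \<partial>P) = (\<integral>\<omega>. (\<Sum>c\<in>?C. indicator c \<omega> *\<^sub>R g \<omega>) \<partial>P)"
    by (simp add: set_lebesgue_integral_def sum_distrib_right)
  also have "\<dots> = (\<Sum>c\<in>?C. \<integral>\<omega>\<in>c. g \<omega> \<partial>P)"
    unfolding set_lebesgue_integral_def using assms(3) cyl_sets[OF assms(1)]
    by (intro Bochner_Integration.integral_sum integrable_mult_indicator) auto
  finally show ?thesis .
qed

text \<open>The defining integrals need to be compared only on the finitely many cylinders over
  \<open>V\<close>, on each of which \<open>origin_prob\<close> is constant.\<close>

lemma cond_law0_finite:
  assumes "finite V" "(0, 0) \<notin> V"
  shows "AE \<omega> in P. cond_law0 P (sigF P V) \<omega> y = origin_prob V y \<omega>"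
proof -
  interpret F: sigma_finite_subalgebra P "sigF P V" by (rule sigma_finite_subalgebraI[OF sigF_subalgebra])
  have m: "origin_prob V y \<in> borel_measurable P"
    by (rule measurable_from_subalg[OF sigF_subalgebra origin_prob_measurable[OF assms(1)]])
  have i2: "integrable P (origin_prob V y)"
  proof (rule integrable_bounded[where B = 1, OF m])
    show "\<bar>origin_prob V y \<omega>\<bar> \<le> 1" for \<omega>
      using origin_prob_bounds[OF assms, of y \<omega>] c0_pos by linarith
  qed
  have i1: "integrable P (indicator (origin_is y) :: _ \<Rightarrow> real)"
    by (simp add: emeasure_eq_measure)
  have "AE \<omega> in P. real_cond_exp P (sigF P V) (indicator (origin_is y)) \<omega> = origin_prob V y \<omega>"
  proof (rule F.real_cond_exp_charact[OF _ i1 i2 origin_prob_measurable[OF assms(1)]])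
    fix A assume A: "A \<in> sets (sigF P V)"
    have "(\<integral>\<omega>\<in>c. indicator (origin_is y) \<omega> \<partial>P) = (\<integral>\<omega>\<in>c. origin_prob V y \<omega> \<partial>P)" if "c \<in> range (cyl V)" for c
    proof -
      obtain \<eta> where c: "c = cyl V \<eta>" using \<open>c \<in> range (cyl V)\<close> by auto
      have [measurable]: "c \<in> sets P" using c cyl_sets[OF assms(1)] by simp
      have "(\<integral>\<omega>\<in>c. indicator (origin_is y) \<omega> \<partial>P) = (\<integral>\<omega>. indicator (origin_is y \<inter> c) \<omega> \<partial>P)"
        unfolding set_lebesgue_integral_def by (intro Bochner_Integration.integral_cong) (auto simp: indicator_def)
      also have "\<dots> = prob (origin_is y \<inter> c)" by simp
      also have "\<dots> = origin_prob V y \<eta> * prob c"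
        using prob_cyl_pos[OF assms(1), of \<eta>] by (simp add: origin_prob_def c)
      also have "\<dots> = (\<integral>\<omega>. origin_prob V y \<eta> * indicator c \<omega> \<partial>P)" by simp
      also have "\<dots> = (\<integral>\<omega>\<in>c. origin_prob V y \<omega> \<partial>P)"
        unfolding set_lebesgue_integral_def
        by (intro Bochner_Integration.integral_cong) (use cyl_eq_iff[of _ V \<eta>] in \<open>auto simp: indicator_def c origin_prob_def\<close>)
      finally show ?thesis .
    qed
    then show "(\<integral>\<omega>\<in>A. indicator (origin_is y) \<omega> \<partial>P) = (\<integral>\<omega>\<in>A. origin_prob V y \<omega> \<partial>P)"
      unfolding set_integral_sum_cyl[OF assms(1) A i1] set_integral_sum_cyl[OF assms(1) A i2]
      by (intro sum.cong) auto
  qed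
  then show ?thesis by (simp add: cond_law0_def origin_is_def)
qed

end

section \<open>Conditional entropy and information gain\<close>

context random_field
begin

abbreviation cond_law :: "(int \<times> int) set \<Rightarrow> 'y \<Rightarrow> 'y config \<Rightarrow> real" where
  "cond_law V y \<omega> \<equiv> real_cond_exp P (sigF P V) (indicator (origin_is y)) \<omega>"

lemma cond_law0_eq: "cond_law0 P (sigF P V) \<omega> y = cond_law V y \<omega>"
  by (simp add: cond_law0_def origin_is_def)

lemma origin_indicator_measurable: "(indicator (origin_is y) :: _ \<Rightarrow> real) \<in> borel_measurable P"
  by simp

lemmas cond_law_measurable [measurable] = cond_exp_measurable(2)[OF sigF_subalgebra]

text \<open>The name: the sum of the squares of a law is the probability that two independent
  samples from it coincide.\<close>

definition collision :: "(int \<times> int) set \<Rightarrow> real" where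
  "collision V = (\<Sum>y\<in>UNIV. cond_sq (sigF P V) (indicator (origin_is y)))"

lemma collision_mono: "V \<subseteq> W \<Longrightarrow> collision V \<le> collision W"
  unfolding collision_def
  by (intro sum_mono cond_sq_mono[OF sigF_subalgebra sigF_mono origin_indicator_measurable abs_indicator_le_1])

lemma collision_bounds: "0 \<le> collision V" "collision V \<le> real CARD('y)"
proof -
  note b = cond_sq_bounds[OF sigF_subalgebra[of V] origin_indicator_measurable abs_indicator_le_1]
  show "0 \<le> collision V" unfolding collision_def by (intro sum_nonneg b)
  have "collision V \<le> (\<Sum>y\<in>(UNIV :: 'y set). 1)"
    unfolding collision_def by (intro sum_mono) (use b(2) in simp)
  then show "collision V \<le> real CARD('y)" by simp
qed

text \<open>Every symbol contributes a nonnegative increment, so the total increment dominates that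
  of \<open>y\<close> and gives a bound uniform in \<open>y\<close>.\<close>

lemma cond_law_diff:
  assumes "V \<subseteq> W"
  shows "expectation (\<lambda>\<omega>. \<bar>cond_law W y \<omega> - cond_law V y \<omega>\<bar>) \<le> sqrt (collision W - collision V)"
proof -
  have *: "cond_sq (sigF P V) (indicator (origin_is z)) \<le> cond_sq (sigF P W) (indicator (origin_is z))" for z
    by (intro cond_sq_mono[OF sigF_subalgebra sigF_mono[OF assms] origin_indicator_measurable abs_indicator_le_1])
  have "expectation (\<lambda>\<omega>. \<bar>cond_law W y \<omega> - cond_law V y \<omega>\<bar>)
    \<le> sqrt (cond_sq (sigF P W) (indicator (origin_is y)) - cond_sq (sigF P V) (indicator (origin_is y)))"
    by (rule cond_exp_diff_abs[OF sigF_subalgebra sigF_mono[OF assms] origin_indicator_measurable abs_indicator_le_1])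
  also have "\<dots> \<le> sqrt (\<Sum>z\<in>UNIV. cond_sq (sigF P W) (indicator (origin_is z)) - cond_sq (sigF P V) (indicator (origin_is z)))"
    using * by (intro real_sqrt_le_mono member_le_sum[of y UNIV "\<lambda>z. cond_sq (sigF P W) (indicator (origin_is z)) - cond_sq (sigF P V) (indicator (origin_is z))"]) auto
  finally show ?thesis by (simp add: collision_def sum_subtractf)
qed

lemma cond_law_integrable: "integrable P (cond_law V y)"
  by (rule integrable_cond_exp[OF sigF_subalgebra origin_indicator_measurable abs_indicator_le_1])

lemma cond_law_le_1: "AE \<omega> in P. \<forall>y. cond_law V y \<omega> \<le> 1"
proof -
  have "AE \<omega> in P. cond_law V y \<omega> \<le> 1" for y
    using cond_exp_bounded[OF sigF_subalgebra[of V] origin_indicator_measurable abs_indicator_le_1, of y]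
    by eventually_elim simp
  then show ?thesis by (simp add: AE_all_countable)
qed

lemma cond_law_ge:
  assumes "(0, 0) \<notin> V"
  shows "AE \<omega> in P. \<forall>y. c0 \<le> cond_law V y \<omega>"
proof -
  have "AE \<omega> in P. c0 \<le> cond_law V y \<omega>" for y
  proof -
    interpret F: sigma_finite_subalgebra P "sigF P V" by (rule sigma_finite_subalgebraI[OF sigF_subalgebra])
    \<comment> \<open>The set where the bound fails belongs to the conditioning sigma-algebra, so
      condition (B) can be applied to this very set.\<close>
    define A where "A = {\<omega> \<in> space (sigF P V). cond_law V y \<omega> < c0}"
    have A: "A \<in> sets (sigF P V)"
      unfolding A_def by measurable
    note [measurable] = sigF_sets_P[OF A]
    have i1: "integrable P (indicator (origin_is y) :: _ \<Rightarrow> real)"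
      by (simp add: emeasure_eq_measure)
    have "\<not> 0 < prob A"
    proof
      assume "0 < prob A"
      then have "c0 * prob A < prob (origin_is y \<inter> A)"
        by (rule cond_B'[OF A assms])
      also have "\<dots> = (\<integral>\<omega>. indicator (origin_is y \<inter> A) \<omega> \<partial>P)" by simp
      also have "\<dots> = (\<integral>\<omega>\<in>A. indicator (origin_is y) \<omega> \<partial>P)"
        unfolding set_lebesgue_integral_def by (intro Bochner_Integration.integral_cong) (auto simp: indicator_def)
      also have "\<dots> = (\<integral>\<omega>\<in>A. cond_law V y \<omega> \<partial>P)"
        by (rule F.real_cond_exp_intA[OF i1 A])
      also have "\<dots> \<le> (\<integral>\<omega>. c0 * indicator A \<omega> \<partial>P)"
        unfolding set_lebesgue_integral_def
      proof (rule integral_mono)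
        show "integrable P (\<lambda>\<omega>. indicator A \<omega> *\<^sub>R cond_law V y \<omega>)"
          by (rule integrable_mult_indicator[OF sigF_sets_P[OF A] cond_law_integrable])
        show "integrable P (\<lambda>\<omega>. c0 * indicator A \<omega>)"
          by (simp add: emeasure_eq_measure)
        show "indicator A \<omega> *\<^sub>R cond_law V y \<omega> \<le> c0 * indicator A \<omega>" for \<omega>
          by (auto simp: indicator_def A_def)
      qed
      also have "\<dots> = c0 * prob A" by simp
      finally show False by simp
    qed
    then have "prob A = 0" using measure_nonneg[of P A] by linarith
    then have "A \<in> null_sets P" by (auto simp: emeasure_eq_measure)
    from AE_not_in[OF this] show ?thesis
      by eventually_elim (auto simp: A_def)
  qed
  then show ?thesis by (simp add: AE_all_countable)
qed

definition cond_entropy :: "(int \<times> int) set \<Rightarrow> real" where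
  "cond_entropy V = expectation (\<lambda>\<omega>. entropy_fn (cond_law0 P (sigF P V) \<omega>))"

text \<open>On \<open>[c0, 1]\<close> the map \<open>x * ln x\<close> has Lipschitz constant at most
  \<open>2 / c0\<close>, and the sum runs over all symbols. The same number also bounds the entropy
  and serves for differences of information gains.\<close>

definition lip :: real where "lip = 2 * real CARD('y) / c0"

lemma lip_nonneg: "0 \<le> lip"
  using c0_pos by (simp add: lip_def)

lemma entropy_fn_cond_law: "entropy_fn (cond_law0 P (sigF P V) \<omega>) = - (\<Sum>y\<in>UNIV. cond_law V y \<omega> * ln (cond_law V y \<omega>))"
  by (simp add: entropy_fn_def cond_law0_eq)

lemma integrable_cond_law_ln:
  assumes "(0, 0) \<notin> V"
  shows "integrable P (\<lambda>\<omega>. cond_law V y \<omega> * ln (cond_law V y \<omega>))"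
proof (rule integrable_const_bound[where B = "2 / c0"])
  show "AE \<omega> in P. norm (cond_law V y \<omega> * ln (cond_law V y \<omega>)) \<le> 2 / c0"
    using cond_law_ge[OF assms] cond_law_le_1[of V]
    by eventually_elim (use abs_mult_ln_le[OF c0_pos] in auto)
qed measurable

lemma cond_entropy_eq:
  assumes "(0, 0) \<notin> V"
  shows "cond_entropy V = - (\<Sum>y\<in>UNIV. expectation (\<lambda>\<omega>. cond_law V y \<omega> * ln (cond_law V y \<omega>)))"
  unfolding cond_entropy_def entropy_fn_cond_law
  using integrable_cond_law_ln[OF assms] by simp

text \<open>Both conditional laws lie in \<open>[c0, 1]\<close> almost everywhere, where
  \<open>x * ln x\<close> is Lipschitz. The sets may be infinite, as is required for the full
  half-line.\<close>

lemma cond_entropy_diff: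
  assumes "V \<subseteq> W" "(0, 0) \<notin> W"
  shows "\<bar>cond_entropy W - cond_entropy V\<bar> \<le> lip * sqrt (collision W - collision V)"
proof -
  have V: "(0, 0) \<notin> V" using assms by auto
  let ?f = "\<lambda>V y \<omega>. cond_law V y \<omega> * ln (cond_law V y \<omega>)"
  have 1: "\<bar>expectation (?f V y) - expectation (?f W y)\<bar> \<le> 2 / c0 * sqrt (collision W - collision V)" for y
  proof -
    have "\<bar>expectation (?f V y) - expectation (?f W y)\<bar> = \<bar>expectation (\<lambda>\<omega>. ?f V y \<omega> - ?f W y \<omega>)\<bar>"
      using integrable_cond_law_ln[OF V] integrable_cond_law_ln[OF assms(2)] by simp
    also have "\<dots> \<le> expectation (\<lambda>\<omega>. \<bar>?f V y \<omega> - ?f W y \<omega>\<bar>)"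
      by (rule integral_abs_bound)
    also have "\<dots> \<le> expectation (\<lambda>\<omega>. 2 / c0 * \<bar>cond_law W y \<omega> - cond_law V y \<omega>\<bar>)"
    proof (rule integral_mono_AE)
      show "AE \<omega> in P. \<bar>?f V y \<omega> - ?f W y \<omega>\<bar> \<le> 2 / c0 * \<bar>cond_law W y \<omega> - cond_law V y \<omega>\<bar>"
        using cond_law_ge[OF V] cond_law_le_1[of V] cond_law_ge[OF assms(2)] cond_law_le_1[of W]
      proof eventually_elim
        case (elim \<omega>)
        then show ?case
          by (subst (2) abs_minus_commute) (intro abs_mult_ln_diff_le[OF c0_pos], auto)
      qed
    qed (use integrable_cond_law_ln[OF V] integrable_cond_law_ln[OF assms(2)] cond_law_integrable in auto)
    also have "\<dots> = 2 / c0 * expectation (\<lambda>\<omega>. \<bar>cond_law W y \<omega> - cond_law V y \<omega>\<bar>)" by simp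
    also have "\<dots> \<le> 2 / c0 * sqrt (collision W - collision V)"
      using c0_pos by (intro mult_left_mono cond_law_diff assms) auto
    finally show ?thesis .
  qed
  have "\<bar>cond_entropy W - cond_entropy V\<bar> = \<bar>\<Sum>y\<in>UNIV. expectation (?f V y) - expectation (?f W y)\<bar>"
    unfolding cond_entropy_eq[OF V] cond_entropy_eq[OF assms(2)] sum_subtractf by simp
  also have "\<dots> \<le> (\<Sum>y\<in>UNIV. \<bar>expectation (?f V y) - expectation (?f W y)\<bar>)"
    by (rule sum_abs)
  also have "\<dots> \<le> (\<Sum>y\<in>(UNIV :: 'y set). 2 / c0 * sqrt (collision W - collision V))"
    by (intro sum_mono 1)
  also have "\<dots> = lip * sqrt (collision W - collision V)" by (simp add: lip_def)
  finally show ?thesis .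
qed

text \<open>This is the conditional information of the symbol at the origin given the symbols on
  \<open>V\<close>. Written as a difference, it telescopes along the line.\<close>

definition info_gain :: "(int \<times> int) set \<Rightarrow> 'y config \<Rightarrow> real" where
  "info_gain V \<omega> = info P (insert (0, 0) V) \<omega> - info P V \<omega>"

lemma info_gain_eq: "finite V \<Longrightarrow> (0, 0) \<notin> V \<Longrightarrow> info_gain V \<omega> = - ln (origin_prob V (\<omega> (0, 0)) \<omega>)"
  using prob_cyl_pos[of V \<omega>] prob_cyl_pos[of "insert (0, 0) V" \<omega>]
  by (simp add: info_gain_def info_cyl origin_prob_def cyl_insert_origin ln_div)

lemma info_gain_bounds:
  assumes "finite V" "(0, 0) \<notin> V"
  shows "0 \<le> info_gain V \<omega>" "info_gain V \<omega> \<le> - ln c0"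
  using origin_prob_bounds[OF assms, of "\<omega> (0, 0)" \<omega>] c0_pos
  by (auto simp: info_gain_eq[OF assms])

lemma info_measurable_sigF:
  assumes "finite V" "V \<subseteq> W" "finite W"
  shows "info P V \<in> borel_measurable (sigF P W)"
proof (rule local_measurable[OF assms(3)])
  fix \<omega> \<eta> :: "'y config" assume "\<And>v. v \<in> W \<Longrightarrow> \<eta> v = \<omega> v"
  then have "cyl V \<eta> = cyl V \<omega>" using assms(2) by (auto simp: cyl_def subset_iff)
  then show "info P V \<eta> = info P V \<omega>" by (simp add: info_cyl)
qed

lemma info_measurable: "finite V \<Longrightarrow> info P V \<in> borel_measurable P"
  by (rule measurable_from_subalg[OF sigF_subalgebra info_measurable_sigF[OF _ subset_refl]])

lemma info_gain_measurable: "finite V \<Longrightarrow> info_gain V \<in> borel_measurable P"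
  unfolding info_gain_def using info_measurable by (intro borel_measurable_diff) auto

lemma abs_info_gain_le:
  assumes "finite V" "(0, 0) \<notin> V"
  shows "\<bar>info_gain V \<omega>\<bar> \<le> - ln c0"
  using info_gain_bounds[OF assms, of \<omega>] by simp

lemma info_gain_integrable:
  assumes "finite V" "(0, 0) \<notin> V"
  shows "integrable P (info_gain V)"
  by (rule integrable_bounded[OF info_gain_measurable[OF assms(1)] abs_info_gain_le[OF assms]])

lemma info_gain_AE:
  assumes "finite V" "(0, 0) \<notin> V"
  shows "AE \<omega> in P. info_gain V \<omega> = - ln (cond_law V (\<omega> (0, 0)) \<omega>)"
proof -
  have "AE \<omega> in P. \<forall>y. cond_law V y \<omega> = origin_prob V y \<omega>"
    using cond_law0_finite[OF assms] by (simp add: AE_all_countable cond_law0_eq)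
  then show ?thesis
    by eventually_elim (simp add: info_gain_eq[OF assms])
qed

lemma info_gain_diff:
  assumes "finite W" "V \<subseteq> W" "(0, 0) \<notin> W"
  shows "expectation (\<lambda>\<omega>. \<bar>info_gain W \<omega> - info_gain V \<omega>\<bar>) \<le> lip * sqrt (collision W - collision V)"
proof -
  have fV: "finite V" and V: "(0, 0) \<notin> V" using assms finite_subset by auto
  have "expectation (\<lambda>\<omega>. \<bar>info_gain W \<omega> - info_gain V \<omega>\<bar>)
    \<le> expectation (\<lambda>\<omega>. \<Sum>y\<in>UNIV. 1 / c0 * \<bar>cond_law W y \<omega> - cond_law V y \<omega>\<bar>)"
  proof (rule integral_mono_AE)
    show "AE \<omega> in P. \<bar>info_gain W \<omega> - info_gain V \<omega>\<bar> \<le> (\<Sum>y\<in>UNIV. 1 / c0 * \<bar>cond_law W y \<omega> - cond_law V y \<omega>\<bar>)"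
      using cond_law_ge[OF V] cond_law_ge[OF assms(3)] info_gain_AE[OF fV V] info_gain_AE[OF assms(1,3)]
    proof eventually_elim
      case (elim \<omega>)
      let ?y = "\<omega> (0, 0)"
      have "\<bar>info_gain W \<omega> - info_gain V \<omega>\<bar> = \<bar>ln (cond_law W ?y \<omega>) - ln (cond_law V ?y \<omega>)\<bar>"
        using elim by simp
      also have "\<dots> \<le> 1 / c0 * \<bar>cond_law W ?y \<omega> - cond_law V ?y \<omega>\<bar>"
        using abs_ln_diff_le[OF c0_pos, of "cond_law W ?y \<omega>" "cond_law V ?y \<omega>"] elim by simp
      \<comment> \<open>The symbol at the origin is random while the L1 bound is for a fixed symbol;
        summing over all \<open>y\<close> removes this dependence.\<close>
      also have "\<dots> \<le> (\<Sum>y\<in>UNIV. 1 / c0 * \<bar>cond_law W y \<omega> - cond_law V y \<omega>\<bar>)"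
        using c0_pos by (intro member_le_sum[where f = "\<lambda>y. 1 / c0 * \<bar>cond_law W y \<omega> - cond_law V y \<omega>\<bar>"]) auto
      finally show ?case .
    qed
  qed (use info_gain_integrable[OF fV V] info_gain_integrable[OF assms(1,3)] cond_law_integrable in auto)
  also have "\<dots> = (\<Sum>y\<in>UNIV. 1 / c0 * expectation (\<lambda>\<omega>. \<bar>cond_law W y \<omega> - cond_law V y \<omega>\<bar>))"
    using cond_law_integrable by simp
  also have "\<dots> \<le> (\<Sum>y\<in>(UNIV :: 'y set). 1 / c0 * sqrt (collision W - collision V))"
    using c0_pos by (intro sum_mono mult_left_mono cond_law_diff assms) auto
  also have "\<dots> \<le> lip * sqrt (collision W - collision V)"
    using c0_pos collision_mono[OF assms(2)] by (simp add: lip_def field_simps)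
  finally show ?thesis .
qed

lemma expectation_info_gain:
  assumes "finite V" "(0, 0) \<notin> V"
  shows "expectation (info_gain V) = cond_entropy V"
proof -
  interpret F: sigma_finite_subalgebra P "sigF P V" by (rule sigma_finite_subalgebraI[OF sigF_subalgebra])
  let ?l = "\<lambda>y \<omega>. ln (origin_prob V y \<omega>)"
  have lF: "?l y \<in> borel_measurable (sigF P V)" for y
    using origin_prob_measurable[OF assms(1), of y] by simp
  have lP[measurable]: "?l y \<in> borel_measurable P" for y
    by (rule measurable_from_subalg[OF sigF_subalgebra lF])
  have lb: "\<bar>?l y \<omega>\<bar> \<le> - ln c0" for y \<omega>
    using origin_prob_bounds[OF assms, of y \<omega>] c0_pos by auto
  have int: "integrable P (\<lambda>\<omega>. ?l y \<omega> * indicator (origin_is y) \<omega>)" for y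
  proof (rule integrable_bounded[where B = "- ln c0"])
    show "\<bar>?l y \<omega> * indicator (origin_is y) \<omega>\<bar> \<le> - ln c0" for \<omega>
      using lb[of y \<omega>] by (auto simp: indicator_def)
  qed measurable
  have "info_gain V \<omega> = - (\<Sum>y\<in>UNIV. ?l y \<omega> * indicator (origin_is y) \<omega>)" for \<omega>
  proof -
    have "(\<Sum>y\<in>UNIV. ?l y \<omega> * indicator (origin_is y) \<omega>) = (\<Sum>y\<in>UNIV. if y = \<omega> (0, 0) then ?l y \<omega> else 0)"
      by (intro sum.cong) (auto simp: indicator_def origin_is_def)
    then show ?thesis by (simp add: info_gain_eq[OF assms] sum.delta)
  qed
  then have "expectation (info_gain V) = expectation (\<lambda>\<omega>. - (\<Sum>y\<in>UNIV. ?l y \<omega> * indicator (origin_is y) \<omega>))"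
    by presburger
  also have "\<dots> = - (\<Sum>y\<in>UNIV. expectation (\<lambda>\<omega>. ?l y \<omega> * indicator (origin_is y) \<omega>))"
    by (subst Bochner_Integration.integral_minus, subst Bochner_Integration.integral_sum) (rule int refl)+
  \<comment> \<open>The logarithm is measurable for the sigma-algebra of \<open>V\<close>, so the
    indicator may be replaced by its conditional expectation, and the expected information becomes
    entropy.\<close>
  also have "\<dots> = - (\<Sum>y\<in>UNIV. expectation (\<lambda>\<omega>. ?l y \<omega> * cond_law V y \<omega>))"
    using F.real_cond_exp_intg(2)[OF int lF] by simp
  also have "\<dots> = - (\<Sum>y\<in>UNIV. expectation (\<lambda>\<omega>. cond_law V y \<omega> * ln (cond_law V y \<omega>)))"
  proof -
    have "expectation (\<lambda>\<omega>. ?l y \<omega> * cond_law V y \<omega>) = expectation (\<lambda>\<omega>. cond_law V y \<omega> * ln (cond_law V y \<omega>))" for y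
    proof (rule integral_cong_AE)
      show "AE \<omega> in P. ?l y \<omega> * cond_law V y \<omega> = cond_law V y \<omega> * ln (cond_law V y \<omega>)"
        using cond_law0_finite[OF assms, of y] unfolding cond_law0_eq by eventually_elim simp
    qed measurable
    then show ?thesis by simp
  qed
  also have "\<dots> = cond_entropy V" by (rule cond_entropy_eq[OF assms(2), symmetric])
  finally show ?thesis .
qed

lemma cond_sq_square_tendsto:
  assumes f: "f \<in> borel_measurable P" "\<And>x. \<bar>f x\<bar> \<le> B"
  shows "(\<lambda>k. cond_sq (sigF P (V \<inter> square k)) f) \<longlonglongrightarrow> cond_sq (sigF P V) f"
proof (rule cond_sq_increasing_tendsto[OF sigF_subalgebra sigF_mono sigF_mono _ f])
  show "sets (sigF P V) = sigma_sets (space P) (\<Union>n. sets (sigF P (V \<inter> square n)))"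
  proof
    have "{{\<omega>. \<omega> v = y} |v y. v \<in> V} \<subseteq> (\<Union>n. sets (sigF P (V \<inter> square n)))"
    proof
      fix A :: "'y config set" assume "A \<in> {{\<omega>. \<omega> v = y} |v y. v \<in> V}"
      then obtain v y where v: "v \<in> V" "A = {\<omega>. \<omega> v = y}" by blast
      obtain k where "{v} \<subseteq> square k" using finite_subset_square[of "{v}"] by blast
      then have "A \<in> sets (sigF P (V \<inter> square k))" using v coord_sigF[of v "V \<inter> square k" y] by simp
      then show "A \<in> (\<Union>n. sets (sigF P (V \<inter> square n)))" by blast
    qed
    then show "sets (sigF P V) \<subseteq> sigma_sets (space P) (\<Union>n. sets (sigF P (V \<inter> square n)))"
      unfolding sets_sigF[of V] by (simp add: sigma_sets_mono')
    have "(\<Union>n. sets (sigF P (V \<inter> square n))) \<subseteq> sets (sigF P V)"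
      using sigF_mono[of "V \<inter> square n" V for n] unfolding subalgebra_def by blast
    then show "sigma_sets (space P) (\<Union>n. sets (sigF P (V \<inter> square n))) \<subseteq> sets (sigF P V)"
      using sets.sigma_sets_subset[of _ "sigF P V"] by simp
  qed
qed (use square_mono in blast)+

text \<open>Squares are cofinal among finite sets, so a set lying in all these sigma-algebras lies
  in the intersection of the 0-1 law with \<open>J = V\<close>.\<close>

lemma cond_sq_cofinite_tendsto:
  assumes f: "f \<in> borel_measurable P" "\<And>x. \<bar>f x\<bar> \<le> B"
  shows "(\<lambda>k. cond_sq (sigF P (V \<union> (UNIV - square k))) f) \<longlonglongrightarrow> cond_sq (sigF P V) f"
proof (rule cond_sq_decreasing_tendsto[OF sigF_subalgebra sigF_mono sigF_mono _ f])
  fix A assume A: "\<And>n. A \<in> sets (sigF P (V \<union> (UNIV - square n)))"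
  have "A \<in> sets (sigF P (V \<union> (UNIV - W)))" if W: "finite W" for W
  proof -
    obtain k where "W \<subseteq> square k" using finite_subset_square[OF W] by blast
    then have "V \<union> (UNIV - square k) \<subseteq> V \<union> (UNIV - W)" by blast
    from sigF_mono[OF this] show ?thesis using A[of k] by (auto simp: subalgebra_def)
  qed
  then show "\<exists>B\<in>sets (sigF P V). emeasure P ((A - B) \<union> (B - A)) = 0"
    using strong_law unfolding strong_01_law_def by blast
qed (use square_mono in blast)+

lemma collision_square_tendsto: "(\<lambda>k. collision (V \<inter> square k)) \<longlonglongrightarrow> collision V"
  unfolding collision_def
  by (intro tendsto_sum cond_sq_square_tendsto[OF origin_indicator_measurable abs_indicator_le_1])

lemma collision_cofinite_tendsto: "(\<lambda>k. collision (V \<union> (UNIV - square k))) \<longlonglongrightarrow> collision V"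
  unfolding collision_def
  by (intro tendsto_sum cond_sq_cofinite_tendsto[OF origin_indicator_measurable abs_indicator_le_1])

end

section \<open>Mixing\<close>

text \<open>A second moment bound: distant pairs contribute at most \<open>\<epsilon>\<close> each,
  and every index has at most \<open>2 * d + 1\<close> close partners, bounded by
  \<open>C\<^sup>2\<close>. Where \<open>i - d\<close> is cut off at 0, the range of partners only
  gets shorter.\<close>

lemma (in prob_space) expectation_abs_average_le:
  fixes Z :: "nat \<Rightarrow> 'a \<Rightarrow> real"
  assumes Z[measurable]: "\<And>i. Z i \<in> borel_measurable M" and C: "\<And>i x. \<bar>Z i x\<bar> \<le> C"
    and cov: "\<And>i j. i + d < j \<Longrightarrow> \<bar>expectation (\<lambda>x. Z i x * Z j x)\<bar> \<le> \<epsilon>" and "0 \<le> \<epsilon>"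
  shows "expectation (\<lambda>x. \<bar>(\<Sum>i\<le>n. Z i x) / real (n + 1)\<bar>)
      \<le> sqrt (\<epsilon> + real (2 * d + 1) * C\<^sup>2 / real (n + 1))"
proof -
  have C0: "0 \<le> C" using C order_trans[OF abs_ge_zero] by blast
  have ZZ: "\<bar>Z i x * Z j x\<bar> \<le> C\<^sup>2" for i j x
    unfolding abs_mult power2_eq_square using C C0 by (intro mult_mono) auto
  have int: "integrable M (\<lambda>x. Z i x * Z j x)" for i j
    by (rule integrable_bounded[OF _ ZZ]) measurable
  have e1: "expectation (\<lambda>x. Z i x * Z j x) \<le> \<epsilon> + (if j \<in> {i - d..i + d} then C\<^sup>2 else 0)" for i j
  proof -
    consider "i + d < j" | "j + d < i" | "j \<in> {i - d..i + d}" by fastforce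
    then show ?thesis
    proof cases
      case 1 then show ?thesis using cov[of i j] by auto
    next
      case 2 then show ?thesis using cov[of j i] by (auto simp: mult.commute)
    next
      case 3
      have "expectation (\<lambda>x. Z i x * Z j x) \<le> expectation (\<lambda>x. C\<^sup>2)"
        using ZZ[of i _ j] by (intro integral_mono int) (auto simp: abs_le_iff)
      then show ?thesis using 3 \<open>0 \<le> \<epsilon>\<close> by (simp add: prob_space)
    qed
  qed
  have e2: "(\<Sum>j\<le>n. if j \<in> {i - d..i + d} then C\<^sup>2 else 0) \<le> real (2 * d + 1) * C\<^sup>2" for i
  proof -
    have "(\<Sum>j\<le>n. if j \<in> {i - d..i + d} then C\<^sup>2 else 0) = real (card ({..n} \<inter> {i - d..i + d})) * C\<^sup>2"
      by (simp only: sum.inter_restrict[OF finite_atMost, symmetric] sum_constant)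
    also have "\<dots> \<le> real (2 * d + 1) * C\<^sup>2"
    proof (intro mult_right_mono)
      have "card ({..n} \<inter> {i - d..i + d}) \<le> card {i - d..i + d}" by (intro card_mono) auto
      also have "\<dots> \<le> 2 * d + 1" by simp
      finally show "real (card ({..n} \<inter> {i - d..i + d})) \<le> real (2 * d + 1)" by linarith
    qed simp
    finally show ?thesis .
  qed
  let ?S = "\<lambda>x. (\<Sum>i\<le>n. Z i x) / real (n + 1)"
  have sq: "(?S x)\<^sup>2 = (\<Sum>i\<le>n. \<Sum>j\<le>n. Z i x * Z j x) / (real (n + 1))\<^sup>2" for x
    by (simp add: power_divide power2_eq_square sum_product)
  have int2: "integrable M (\<lambda>x. (?S x)\<^sup>2)"
    unfolding sq using int by (intro integrable_divide Bochner_Integration.integrable_sum) auto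
  have int1: "integrable M ?S"
    by (intro integrable_divide_zero Bochner_Integration.integrable_sum integrable_bounded[OF Z C])
  have "expectation (\<lambda>x. (?S x)\<^sup>2) = (\<Sum>i\<le>n. \<Sum>j\<le>n. expectation (\<lambda>x. Z i x * Z j x)) / (real (n + 1))\<^sup>2"
    unfolding sq using int by simp
  also have "\<dots> \<le> (\<Sum>i\<le>n. \<Sum>j\<le>n. \<epsilon> + (if j \<in> {i - d..i + d} then C\<^sup>2 else 0)) / (real (n + 1))\<^sup>2"
    by (intro divide_right_mono sum_mono e1) auto
  also have "\<dots> \<le> (\<Sum>i\<le>n. real (n + 1) * \<epsilon> + real (2 * d + 1) * C\<^sup>2) / (real (n + 1))\<^sup>2"
    using e2 by (intro divide_right_mono sum_mono) (auto simp: sum.distrib)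
  also have "\<dots> = real (n + 1) * (real (n + 1) * \<epsilon> + real (2 * d + 1) * C\<^sup>2) / (real (n + 1))\<^sup>2"
    by simp
  also have "\<dots> = \<epsilon> + real (2 * d + 1) * C\<^sup>2 / real (n + 1)"
    by (simp add: power2_eq_square add_divide_distrib)
  finally show ?thesis
    using expectation_abs_le_sqrt[OF int1 int2] by (meson order_trans real_sqrt_le_mono)
qed

context random_field
begin

text \<open>The identity holds at every \<open>\<omega>\<close>, as a function measurable for the
  trivial sigma-algebra is literally constant.\<close>

lemma cond_exp_trivial:
  assumes "integrable P f"
  shows "real_cond_exp P (sigF P {}) f \<omega> = expectation f"
proof -
  let ?g = "real_cond_exp P (sigF P {}) f"
  interpret F: sigma_finite_subalgebra P "sigF P {}" by (rule sigma_finite_subalgebraI[OF sigF_subalgebra])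
  have const: "?g \<eta> = ?g \<omega>" for \<eta>
  proof -
    have "?g -` {?g \<omega>} \<inter> space (sigF P {}) \<in> sets (sigF P {})"
      by (intro measurable_sets[of ?g _ borel]) auto
    from sigF_determined[OF this, of \<eta> \<omega>] show ?thesis by simp
  qed
  have "expectation f = expectation ?g"
    by (rule F.real_cond_exp_int(2)[OF assms, symmetric])
  also have "\<dots> = expectation (\<lambda>_. ?g \<omega>)" by (intro Bochner_Integration.integral_cong refl const)
  finally show ?thesis by (simp add: prob_space)
qed

text \<open>For bounded measurable \<open>f\<close> this is the L2 distance between its conditional
  expectation given the exterior of the square and its mean.\<close>

definition mixing :: "nat \<Rightarrow> ('y config \<Rightarrow> real) \<Rightarrow> real" where
  "mixing m f = sqrt (cond_sq (sigF P (UNIV - square m)) f - cond_sq (sigF P {}) f)"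

lemma mixing_tendsto_0:
  assumes "f \<in> borel_measurable P" "\<And>x. \<bar>f x\<bar> \<le> B"
  shows "(\<lambda>m. mixing m f) \<longlonglongrightarrow> 0"
proof -
  have "(\<lambda>m. sqrt (cond_sq (sigF P (UNIV - square m)) f - cond_sq (sigF P {}) f))
     \<longlonglongrightarrow> sqrt (cond_sq (sigF P {}) f - cond_sq (sigF P {}) f)"
    using cond_sq_cofinite_tendsto[OF assms, of "{}"] by (intro tendsto_intros) simp
  then show ?thesis by (simp add: mixing_def)
qed

text \<open>As \<open>g\<close> depends on the exterior alone, \<open>f\<close> may be replaced by
  its conditional expectation given the exterior, whose distance from the mean is what
  \<open>mixing\<close> measures.\<close>

lemma covariance_le_mixing:
  assumes f: "f \<in> borel_measurable P" "\<And>x. \<bar>f x\<bar> \<le> B"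
    and g: "g \<in> borel_measurable (sigF P (UNIV - square m))" "\<And>x. \<bar>g x\<bar> \<le> C"
  shows "\<bar>expectation (\<lambda>\<omega>. f \<omega> * g \<omega>) - expectation f * expectation g\<bar> \<le> C * mixing m f"
proof -
  let ?G = "sigF P (UNIV - square m)"
  interpret G: sigma_finite_subalgebra P ?G by (rule sigma_finite_subalgebraI[OF sigF_subalgebra])
  have gP: "g \<in> borel_measurable P" by (rule measurable_from_subalg[OF sigF_subalgebra g(1)])
  note [measurable] = f(1) gP
  have C0: "0 \<le> C" using g(2) order_trans[OF abs_ge_zero] by blast
  have fi: "integrable P f" by (rule integrable_bounded[OF f])
  have gi: "integrable P g" by (rule integrable_bounded[OF gP g(2)])
  have fg: "integrable P (\<lambda>\<omega>. g \<omega> * f \<omega>)"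
  proof (rule integrable_bounded[where B = "C * B"])
    show "\<bar>g \<omega> * f \<omega>\<bar> \<le> C * B" for \<omega>
      unfolding abs_mult using C0 by (intro mult_mono g f) auto
  qed measurable
  let ?e = "real_cond_exp P ?G f"
  have gei: "integrable P (\<lambda>\<omega>. g \<omega> * ?e \<omega>)"
    using G.real_cond_exp_intg(1)[OF fg g(1) f(1)] .
  have ei: "integrable P ?e" by (rule integrable_cond_exp[OF sigF_subalgebra f])
  have "expectation (\<lambda>\<omega>. f \<omega> * g \<omega>) = expectation (\<lambda>\<omega>. g \<omega> * ?e \<omega>)"
    using G.real_cond_exp_intg(2)[OF fg g(1) f(1)] by (simp add: mult.commute)
  then have "expectation (\<lambda>\<omega>. f \<omega> * g \<omega>) - expectation f * expectation g
      = expectation (\<lambda>\<omega>. g \<omega> * ?e \<omega>) - expectation (\<lambda>\<omega>. expectation f * g \<omega>)"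
    by simp
  also have "\<dots> = expectation (\<lambda>\<omega>. g \<omega> * ?e \<omega> - expectation f * g \<omega>)"
    using gei gi by simp
  also have "\<dots> = expectation (\<lambda>\<omega>. g \<omega> * (?e \<omega> - expectation f))"
    by (simp add: algebra_simps)
  finally have "\<bar>expectation (\<lambda>\<omega>. f \<omega> * g \<omega>) - expectation f * expectation g\<bar>
      = \<bar>expectation (\<lambda>\<omega>. g \<omega> * (?e \<omega> - expectation f))\<bar>" by simp
  also have "\<dots> \<le> expectation (\<lambda>\<omega>. \<bar>g \<omega> * (?e \<omega> - expectation f)\<bar>)"
    by (rule integral_abs_bound)
  also have "\<dots> \<le> expectation (\<lambda>\<omega>. C * \<bar>?e \<omega> - expectation f\<bar>)"
  proof (rule integral_mono)
    show "integrable P (\<lambda>\<omega>. \<bar>g \<omega> * (?e \<omega> - expectation f)\<bar>)"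
      using gei gi by (intro integrable_abs) (simp add: right_diff_distrib)
    show "\<bar>g \<omega> * (?e \<omega> - expectation f)\<bar> \<le> C * \<bar>?e \<omega> - expectation f\<bar>" for \<omega>
      unfolding abs_mult by (intro mult_right_mono g) auto
  qed (use ei in auto)
  also have "\<dots> = C * expectation (\<lambda>\<omega>. \<bar>?e \<omega> - real_cond_exp P (sigF P {}) f \<omega>\<bar>)"
    by (simp add: cond_exp_trivial[OF fi])
  also have "\<dots> \<le> C * mixing m f"
    unfolding mixing_def
    by (intro mult_left_mono C0 cond_exp_diff_abs[OF sigF_subalgebra sigF_mono f]) auto
  finally show ?thesis .
qed

lemma shift_shift: "shift u (shift v \<omega>) = shift (u + v) \<omega>"
  by (simp add: shift_def add.assoc)

lemma info_gain_shift_measurable: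
  assumes "finite S" "\<And>v. v \<in> insert (0, 0) S \<Longrightarrow> v + x \<in> W"
  shows "(\<lambda>\<omega>. info_gain S (shift x \<omega>)) \<in> borel_measurable (sigF P W)"
proof -
  let ?V = "(\<lambda>v. v + x) ` insert (0, 0) S"
  have "(\<lambda>\<omega>. info_gain S (shift x \<omega>)) \<in> borel_measurable (sigF P ?V)"
  proof (rule local_measurable)
    fix \<omega> \<eta> :: "'y config" assume eq: "\<And>v. v \<in> ?V \<Longrightarrow> \<eta> v = \<omega> v"
    then have "shift x \<eta> v = shift x \<omega> v" if "v \<in> insert (0, 0) S" for v
      unfolding shift_def using that by blast
    then have "cyl (insert (0, 0) S) (shift x \<eta>) = cyl (insert (0, 0) S) (shift x \<omega>)"
      "cyl S (shift x \<eta>) = cyl S (shift x \<omega>)"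
      by (simp_all add: cyl_def)
    then show "info_gain S (shift x \<eta>) = info_gain S (shift x \<omega>)"
      by (simp add: info_gain_def info_cyl)
  qed (use assms in simp)
  moreover have "?V \<subseteq> W" using assms(2) by blast
  ultimately show ?thesis using measurable_from_subalg[OF sigF_mono] by blast
qed

text \<open>The patterns \<open>S i\<close> vary with \<open>i\<close>, so the summands do not form
  a stationary sequence, and covariances replace an ergodic theorem. Since a square has finitely
  many subsets, one distance \<open>m\<close> serves for all patterns. Separation in the first
  coordinate is enough to make gains nearly uncorrelated.\<close>

lemma average_info_gain_tendsto:
  assumes S: "\<And>i. S i \<subseteq> square k" "\<And>i. (0, 0) \<notin> S i" and x: "\<And>i. fst (x i) = int i"
  shows "(\<lambda>n. expectation (\<lambda>\<omega>. \<bar>(\<Sum>i\<le>n. info_gain (S i) (shift (x i) \<omega>) - cond_entropy (S i)) / real (n + 1)\<bar>)) \<longlonglongrightarrow> 0"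
proof (rule LIMSEQ_I)
  fix r :: real assume r: "0 < r"
  define C where "C = - ln c0"
  have fin: "finite (S i)" for i using S(1) finite_subset finite_square by blast
  note m = info_gain_measurable[OF fin]
  note b = abs_info_gain_le[OF fin S(2), folded C_def]
  note e = expectation_info_gain[OF fin S(2)]
  have C0: "0 \<le> C" using b order_trans[OF abs_ge_zero] by blast
  \<comment> \<open>The final bound is the square root of \<open>\<epsilon>\<close> plus a vanishing
    term, so \<open>\<epsilon>\<close> must lie below the square of \<open>r\<close>.\<close>
  define \<epsilon> where "\<epsilon> = r\<^sup>2 / 4"
  have \<epsilon>: "0 < \<epsilon>" using r by (simp add: \<epsilon>_def)
  have "\<forall>\<^sub>F m in sequentially. \<forall>T\<in>{T. T \<subseteq> square k \<and> (0, 0) \<notin> T}. C * mixing m (info_gain T) < \<epsilon>"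
  proof (rule eventually_ball_finite)
    show "finite {T. T \<subseteq> square k \<and> (0, 0) \<notin> T}"
      by (rule finite_subset[of _ "Pow (square k)"]) auto
    show "\<forall>T\<in>{T. T \<subseteq> square k \<and> (0, 0) \<notin> T}. \<forall>\<^sub>F m in sequentially. C * mixing m (info_gain T) < \<epsilon>"
    proof
      fix T assume T: "T \<in> {T. T \<subseteq> square k \<and> (0, 0) \<notin> T}"
      then have "finite T" "(0, 0) \<notin> T" using finite_subset finite_square by blast+
      from mixing_tendsto_0[OF info_gain_measurable[OF this(1)] abs_info_gain_le[OF this]]
      have "(\<lambda>m. C * mixing m (info_gain T)) \<longlonglongrightarrow> C * 0" by (intro tendsto_intros)
      then show "\<forall>\<^sub>F m in sequentially. C * mixing m (info_gain T) < \<epsilon>"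
        using \<epsilon> by (intro order_tendstoD(2)) auto
    qed
  qed
  then obtain m where m_mix: "C * mixing m (info_gain (S i)) < \<epsilon>" for i
    using S unfolding eventually_sequentially by blast
  define Z where "Z i \<omega> = info_gain (S i) (shift (x i) \<omega>) - cond_entropy (S i)" for i \<omega>
  have mZ: "(\<lambda>\<omega>. info_gain (S i) (shift v \<omega>)) \<in> borel_measurable P" for i v
    using measurable_compose[OF shift_measurable m] .
  have Z: "Z i \<in> borel_measurable P" for i
    unfolding Z_def using mZ by simp
  have ce: "\<bar>cond_entropy (S i)\<bar> \<le> C" for i
  proof -
    have "\<bar>expectation (info_gain (S i))\<bar> \<le> expectation (\<lambda>\<omega>. \<bar>info_gain (S i) \<omega>\<bar>)" by (rule integral_abs_bound)
    also have "\<dots> \<le> expectation (\<lambda>\<omega>. C)"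
      using b info_gain_integrable[OF fin S(2)] by (intro integral_mono) auto
    finally show ?thesis by (simp add: e prob_space)
  qed
  have Zb: "\<bar>Z i \<omega>\<bar> \<le> 2 * C" for i \<omega>
    unfolding Z_def using b[of i "shift (x i) \<omega>"] ce[of i] by linarith
  \<comment> \<open>A pattern reaches at most \<open>k\<close> columns to the left of its base
    point; a further \<open>m\<close> columns put it outside the square around the earlier base
    point.\<close>
  have cov: "\<bar>expectation (\<lambda>\<omega>. Z i \<omega> * Z j \<omega>)\<bar> \<le> \<epsilon>" if ij: "i + (m + k) < j" for i j
  proof -
    \<comment> \<open>Stationarity moves the pair back by \<open>x i\<close>, so that the earlier
      gain sits at the origin.\<close>
    let ?f = "info_gain (S i)" and ?g = "\<lambda>\<omega>. info_gain (S j) (shift (x j - x i) \<omega>)"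
    have g: "?g \<in> borel_measurable (sigF P (UNIV - square m))"
    proof (rule info_gain_shift_measurable[OF fin])
      fix v assume "v \<in> insert (0, 0) (S j)"
      then have "- int k \<le> fst v" using S(1)[of j] by (auto simp: square_def)
      then have "int m < fst (v + (x j - x i))" using ij by (simp add: x)
      then show "v + (x j - x i) \<in> UNIV - square m" by (simp add: square_def mem_Times_iff)
    qed
    have gm: "?g \<in> borel_measurable P" by (rule mZ)
    have fi: "integrable P ?f" by (rule integrable_bounded[OF m b])
    have gi: "integrable P ?g" by (rule integrable_bounded[OF gm b])
    have fgi: "integrable P (\<lambda>\<omega>. ?f \<omega> * ?g \<omega>)"
    proof (rule integrable_bounded[where B = "C * C"])
      show "\<bar>?f \<omega> * ?g \<omega>\<bar> \<le> C * C" for \<omega> unfolding abs_mult using C0 by (intro mult_mono b) auto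
    qed (use m gm in measurable)
    have eg: "expectation ?g = cond_entropy (S j)" using expectation_shift[OF m] e by simp
    have "expectation (\<lambda>\<omega>. Z i \<omega> * Z j \<omega>)
       = expectation (\<lambda>\<omega>. (\<lambda>\<eta>. (?f \<eta> - cond_entropy (S i)) * (?g \<eta> - cond_entropy (S j))) (shift (x i) \<omega>))"
      unfolding Z_def by (simp add: shift_shift)
    also have "\<dots> = expectation (\<lambda>\<eta>. (?f \<eta> - cond_entropy (S i)) * (?g \<eta> - cond_entropy (S j)))"
      by (intro expectation_shift borel_measurable_times borel_measurable_diff borel_measurable_const m gm)
    also have "\<dots> = expectation (\<lambda>\<eta>. ?f \<eta> * ?g \<eta> - cond_entropy (S j) * ?f \<eta> - cond_entropy (S i) * ?g \<eta> + cond_entropy (S i) * cond_entropy (S j))"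
      by (simp add: algebra_simps)
    also have "\<dots> = expectation (\<lambda>\<eta>. ?f \<eta> * ?g \<eta>) - expectation ?f * expectation ?g"
      using fi gi fgi by (simp add: eg e prob_space)
    finally have "\<bar>expectation (\<lambda>\<omega>. Z i \<omega> * Z j \<omega>)\<bar> \<le> C * mixing m ?f"
      using covariance_le_mixing[OF m b g b] by simp
    then show ?thesis using m_mix[of i] by linarith
  qed
  note avg = expectation_abs_average_le[of Z "2 * C" "m + k" \<epsilon>, OF Z Zb cov less_imp_le[OF \<epsilon>]]
  define K where "K = real (2 * (m + k) + 1) * (2 * C)\<^sup>2"
  have "(\<lambda>n. \<epsilon> + K / real (n + 1)) \<longlonglongrightarrow> \<epsilon> + 0"
    using LIMSEQ_Suc[OF lim_const_over_n[of K]] by (intro tendsto_add tendsto_const) simp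
  then have "\<forall>\<^sub>F n in sequentially. \<epsilon> + K / real (n + 1) < r\<^sup>2"
    using r by (intro order_tendstoD(2)) (auto simp: \<epsilon>_def)
  then obtain N where N: "\<And>n. n \<ge> N \<Longrightarrow> \<epsilon> + K / real (n + 1) < r\<^sup>2"
    unfolding eventually_sequentially by blast
  show "\<exists>N. \<forall>n\<ge>N. norm (expectation (\<lambda>\<omega>. \<bar>(\<Sum>i\<le>n. info_gain (S i) (shift (x i) \<omega>) - cond_entropy (S i)) / real (n + 1)\<bar>) - 0) < r"
  proof (intro exI allI impI)
    fix n assume "n \<ge> N"
    from N[OF this] have "sqrt (\<epsilon> + K / real (n + 1)) < r" using r by (intro real_less_lsqrt) auto
    then have "expectation (\<lambda>\<omega>. \<bar>(\<Sum>i\<le>n. Z i \<omega>) / real (n + 1)\<bar>) < r"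
      using avg[of n] unfolding K_def by linarith
    moreover have "0 \<le> expectation (\<lambda>\<omega>. \<bar>(\<Sum>i\<le>n. Z i \<omega>) / real (n + 1)\<bar>)" by simp
    ultimately show "norm (expectation (\<lambda>\<omega>. \<bar>(\<Sum>i\<le>n. info_gain (S i) (shift (x i) \<omega>) - cond_entropy (S i)) / real (n + 1)\<bar>) - 0) < r"
      unfolding Z_def by simp
  qed
qed

end

section \<open>The information along a line\<close>

text \<open>For the double limit: the length \<open>n\<close> tends to infinity at a fixed
  truncation \<open>k\<close>, and only then does \<open>k\<close>.\<close>

lemma tendsto_0_of_bounds:
  fixes u :: "nat \<Rightarrow> real"
  assumes "\<And>n. 0 \<le> u n" "\<And>k n. u n \<le> v k n" "\<And>k. v k \<longlonglongrightarrow> c k" "c \<longlonglongrightarrow> 0"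
  shows "u \<longlonglongrightarrow> 0"
proof (rule order_tendstoI)
  fix e :: real assume e: "0 < e"
  then have "\<forall>\<^sub>F k in sequentially. c k < e" using assms(4) by (intro order_tendstoD(2)) auto
  then obtain k where "c k < e" unfolding eventually_sequentially by blast
  then have "\<forall>\<^sub>F n in sequentially. v k n < e" using assms(3) by (intro order_tendstoD(2)) auto
  then show "\<forall>\<^sub>F n in sequentially. u n < e"
    by eventually_elim (use assms(2)[of _ k] in \<open>auto intro: le_less_trans\<close>)
next
  fix e :: real assume "e < 0"
  then have "e < u n" for n
    using assms(1)[of n] by linarith
  then show "\<forall>\<^sub>F n in sequentially. e < u n" by simp
qed

lemma set_integrable_unit_interval:
  fixes f :: "real \<Rightarrow> real"
  assumes [measurable]: "f \<in> borel_measurable borel" and "\<And>t. \<bar>f t\<bar> \<le> B"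
  shows "set_integrable lborel {0..1} f"
  unfolding set_integrable_def
proof (rule Bochner_Integration.integrable_bound[where f = "\<lambda>t. B * indicator {0..1} t"])
  show "AE t in lborel. norm (indicator {0..1} t *\<^sub>R f t) \<le> norm (B * indicator {0..1} t :: real)"
    using assms(2) by (intro AE_I2) (auto simp: indicator_def intro: order_trans[OF _ abs_ge_self])
qed auto

lemma finite_line: "finite U \<Longrightarrow> finite (line lam t U)"
proof -
  assume "finite U"
  moreover have "line lam t U = (\<lambda>z. (z, \<lfloor>lam * of_int z + t\<rfloor>)) ` U"
    by (auto simp: line_def)
  ultimately show ?thesis by simp
qed

lemma mem_line_iff: "v \<in> line lam t U \<longleftrightarrow> fst v \<in> U \<and> snd v = \<lfloor>lam * of_int (fst v) + t\<rfloor>"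
  by (cases v) (auto simp: line_def)

lemma line_mono: "U \<subseteq> U' \<Longrightarrow> line lam t U \<subseteq> line lam t U'"
  by (auto simp: line_def)

lemma origin_notin_line: "U \<subseteq> {..-1} \<Longrightarrow> (0, 0) \<notin> line lam t U"
  by (auto simp: line_def)

section \<open>Patterns of the truncated half-line\<close>

definition window :: "real \<Rightarrow> nat \<Rightarrow> real \<Rightarrow> (int \<times> int) set" where
  "window lam k t = line lam t {..-1} \<inter> square k"

lemma finite_window: "finite (window lam k t)"
  by (simp add: window_def)

lemma origin_notin_window: "(0, 0) \<notin> window lam k t"
  using origin_notin_line[of "{..-1}" lam t] by (simp add: window_def)

text \<open>No regularity of \<open>F\<close> enters: the pattern takes finitely many values, each
  on a Borel set of offsets.\<close>

lemma window_function_measurable: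
  fixes F :: "(int \<times> int) set \<Rightarrow> real"
  shows "(\<lambda>t. F (window lam k t)) \<in> borel_measurable borel"
proof -
  have sets: "{t. window lam k t = S} \<in> sets borel" if "S \<subseteq> square k" for S
  proof -
    have "window lam k t = S \<longleftrightarrow> (\<forall>v\<in>square k. v \<in> line lam t {..-1} \<longleftrightarrow> v \<in> S)" for t
      using that unfolding window_def by blast
    then have "{t. window lam k t = S} = {t \<in> space borel. \<forall>v\<in>square k. (fst v \<le> -1 \<and> snd v = \<lfloor>lam * of_int (fst v) + t\<rfloor>) \<longleftrightarrow> v \<in> S}"
      by (simp add: mem_line_iff)
    also have "\<dots> \<in> sets borel"
    proof (rule sets.sets_Collect_finite_All[OF _ finite_square])
      fix v :: "int \<times> int"
      have [measurable]: "(\<lambda>t. \<lfloor>lam * of_int (fst v) + t\<rfloor>) \<in> measurable borel (count_space UNIV)"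
        by (rule measurable_compose[OF _ measurable_real_floor]) measurable
      show "{t \<in> space borel. (fst v \<le> -1 \<and> snd v = \<lfloor>lam * of_int (fst v) + t\<rfloor>) \<longleftrightarrow> v \<in> S} \<in> sets borel"
        by measurable
    qed
    finally show ?thesis .
  qed
  have "F (window lam k t) = (\<Sum>S\<in>Pow (square k). F S * indicator {t. window lam k t = S} t)" for t
  proof -
    have "(\<Sum>S\<in>Pow (square k). F S * indicator {t. window lam k t = S} t)
        = (\<Sum>S\<in>Pow (square k). if S = window lam k t then F S else 0)"
      by (intro sum.cong) (auto simp: indicator_def)
    moreover have "window lam k t \<in> Pow (square k)" by (simp add: window_def)
    ultimately show ?thesis by (simp add: sum.delta)
  qed
  then have "(\<lambda>t. F (window lam k t)) = (\<lambda>t. \<Sum>S\<in>Pow (square k). F S * indicator {t. window lam k t = S} t)"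
    by (rule ext)
  also have "\<dots> \<in> borel_measurable borel"
    using sets by (intro borel_measurable_sum borel_measurable_times borel_measurable_indicator) auto
  finally show ?thesis .
qed

text \<open>The pattern changes only when one of the columns from \<open>- k\<close> to
  \<open>-1\<close> carries, so the carry thresholds of these columns are the breakpoints.\<close>

lemma equidistributed_window:
  fixes F :: "(int \<times> int) set \<Rightarrow> real"
  assumes "lam \<notin> \<rat>"
  shows "(\<lambda>n. (\<Sum>i\<le>n. F (window lam k (frac (lam * real i + a)))) / real (n + 1))
     \<longlonglongrightarrow> (LBINT t:{0..1}. F (window lam k t))"
proof (rule equidistributed_step[OF assms, where C = "(\<lambda>z. 1 - frac (lam * of_int z)) ` {- int k..-1}"])
  fix s t :: real
  assume st: "0 \<le> s" "s < 1" "0 \<le> t" "t < 1"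
    and eq: "{c \<in> (\<lambda>z. 1 - frac (lam * of_int z)) ` {- int k..-1}. c \<le> s}
           = {c \<in> (\<lambda>z. 1 - frac (lam * of_int z)) ` {- int k..-1}. c \<le> t}"
  have "\<lfloor>lam * of_int z + s\<rfloor> = \<lfloor>lam * of_int z + t\<rfloor>" if "z \<in> {- int k..-1}" for z
  proof -
    have "1 - frac (lam * of_int z) \<le> s \<longleftrightarrow> 1 - frac (lam * of_int z) \<le> t"
      using eq that by blast
    then show ?thesis
      using st by (simp add: floor_add_less_1)
  qed
  then have "window lam k s = window lam k t"
    unfolding window_def by (auto simp: mem_line_iff square_def)
  then show "F (window lam k s) = F (window lam k t)" by simp
qed (use window_function_measurable in auto)

text \<open>At base point \<open>i\<close>, the integer part of \<open>lam * i + a\<close> passes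
  through the floor and becomes a vertical translation; the fractional part remains as the new
  offset.\<close>

lemma line_translate:
  fixes lam a :: real and i :: nat
  shows "line lam a {0..<int i} = (\<lambda>u. u + (int i, \<lfloor>lam * real i + a\<rfloor>)) ` line lam (frac (lam * real i + a)) {- int i..-1}"
    (is "_ = ?f ` ?L")
proof -
  have fl: "\<lfloor>lam * of_int z + frac (lam * real i + a)\<rfloor> + \<lfloor>lam * real i + a\<rfloor> = \<lfloor>lam * of_int (z + int i) + a\<rfloor>" for z
  proof -
    have "lam * of_int (z + int i) + a = lam * of_int z + frac (lam * real i + a) + of_int \<lfloor>lam * real i + a\<rfloor>"
      by (simp add: frac_def algebra_simps)
    then show ?thesis by simp
  qed
  show ?thesis
  proof
    show "?f ` ?L \<subseteq> line lam a {0..<int i}"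
      using fl by (auto simp: line_def)
    show "line lam a {0..<int i} \<subseteq> ?f ` ?L"
    proof
      fix v assume "v \<in> line lam a {0..<int i}"
      then obtain z where z: "0 \<le> z" "z < int i" "v = (z, \<lfloor>lam * of_int z + a\<rfloor>)"
        by (auto simp: line_def)
      let ?u = "(z - int i, \<lfloor>lam * of_int (z - int i) + frac (lam * real i + a)\<rfloor>)"
      have "v = ?f ?u" using fl[of "z - int i"] z by simp
      moreover have "?u \<in> ?L" using z by (auto simp: line_def)
      ultimately show "v \<in> ?f ` ?L" by blast
    qed
  qed
qed

lemma line_insert_last: "line lam a {0..int i} = insert (int i, \<lfloor>lam * real i + a\<rfloor>) (line lam a {0..<int i})"
proof -
  have "{0..int i} = insert (int i) {0..<int i}" by auto
  then show ?thesis by (auto simp: line_def)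
qed

context random_field
begin

lemma info_line_decomposition:
  "info P (line lam a {0..int n}) \<omega> =
     (\<Sum>i\<le>n. info_gain (line lam (frac (lam * real i + a)) {- int i..-1}) (shift (int i, \<lfloor>lam * real i + a\<rfloor>) \<omega>))"
proof -
  let ?W = "\<lambda>i::nat. line lam (frac (lam * real i + a)) {- int i..-1}"
  let ?x = "\<lambda>i::nat. (int i, \<lfloor>lam * real i + a\<rfloor>)"
  have step: "info P (line lam a {0..int i}) \<omega> - info P (line lam a {0..<int i}) \<omega> = info_gain (?W i) (shift (?x i) \<omega>)" for i
  proof -
    have "line lam a {0..int i} = (\<lambda>u. u + ?x i) ` insert (0, 0) (?W i)"
      unfolding line_insert_last line_translate by (simp add: zero_prod_def[symmetric])
    then show ?thesis
      using finite_line[of "{- int i..-1}"] info_shift[of "insert (0, 0) (?W i)" "?x i" \<omega>] info_shift[of "?W i" "?x i" \<omega>]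
      by (simp add: line_translate info_gain_def)
  qed
  show ?thesis
  proof (induction n)
    case 0
    have "info P {} \<omega> = 0" by (simp add: info_def)
    moreover have "line lam a {0..<int 0} = {}" by (simp add: line_def)
    ultimately show ?case using step[of 0] by simp
  next
    case (Suc n)
    have "{0..<int (Suc n)} = {0..int n}" by auto
    then show ?case using Suc step[of "Suc n"] by simp
  qed
qed

text \<open>The upper set keeps the window inside the square instead of referring to the whole
  half-line, which makes the gap a function of the window.\<close>

definition gap :: "real \<Rightarrow> nat \<Rightarrow> real \<Rightarrow> real" where
  "gap lam k t = sqrt (collision (window lam k t \<union> (UNIV - square k)) - collision (window lam k t))"

lemma gap_bounds: "0 \<le> gap lam k t" "gap lam k t \<le> sqrt (real CARD('y))"
proof -
  show "0 \<le> gap lam k t"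
    unfolding gap_def using collision_mono[of "window lam k t" "window lam k t \<union> (UNIV - square k)"] by simp
  show "gap lam k t \<le> sqrt (real CARD('y))"
    unfolding gap_def
    using collision_bounds(2)[of "window lam k t \<union> (UNIV - square k)"] collision_bounds(1)[of "window lam k t"]
    by (intro real_sqrt_le_mono) linarith
qed

lemma gap_measurable [measurable]: "gap lam k \<in> borel_measurable borel"
  unfolding gap_def[abs_def]
  by (rule window_function_measurable[where F = "\<lambda>S. sqrt (collision (S \<union> (UNIV - square k)) - collision S)"])

lemma gap_tendsto_0: "(\<lambda>k. gap lam k t) \<longlonglongrightarrow> 0"
proof -
  let ?L = "line lam t {..-1}"
  \<comment> \<open>The distant part of the half-line is absorbed by the exterior of the square,
    which brings the upper set into the form covered by the 0-1 law.\<close>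
  have eq: "window lam k t \<union> (UNIV - square k) = ?L \<union> (UNIV - square k)" for k
    by (auto simp: window_def)
  have "(\<lambda>k. sqrt (collision (?L \<union> (UNIV - square k)) - collision (?L \<inter> square k))) \<longlonglongrightarrow> sqrt (collision ?L - collision ?L)"
    by (intro tendsto_intros collision_cofinite_tendsto collision_square_tendsto)
  then show ?thesis unfolding gap_def eq unfolding window_def by simp
qed

text \<open>The set \<open>V\<close> is used both as a finite past along the orbit and as the full
  half-line in the limit integral.\<close>

lemma collision_diff_le_gap:
  assumes "window lam k t \<subseteq> V" "V \<subseteq> line lam t {..-1}"
  shows "sqrt (collision V - collision (window lam k t)) \<le> gap lam k t"
proof -
  have "V \<subseteq> window lam k t \<union> (UNIV - square k)" using assms(2) by (auto simp: window_def)
  from collision_mono[OF this] show ?thesis unfolding gap_def by (intro real_sqrt_le_mono) simp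
qed

lemma gap_integral_tendsto_0: "(\<lambda>k. LBINT t:{0..1}. gap lam k t) \<longlonglongrightarrow> 0"
proof -
  have "(\<lambda>k. LBINT t:{0..1}. gap lam k t) \<longlonglongrightarrow> (\<integral>t. 0 \<partial>(lborel :: real measure))"
    unfolding set_lebesgue_integral_def
  proof (rule integral_dominated_convergence[where w = "\<lambda>t::real. sqrt (real CARD('y)) * indicator {0..1} t"])
    show "AE t in lborel. (\<lambda>k. indicator {0..1} t *\<^sub>R gap lam k t) \<longlonglongrightarrow> 0"
      using tendsto_mult_right_zero[OF gap_tendsto_0] by simp
    show "AE t in lborel. norm (indicator {0..1} t *\<^sub>R gap lam k t) \<le> sqrt (real CARD('y)) * indicator {0..1} t" for k
      using gap_bounds[of lam k] by (intro AE_I2) (auto simp: indicator_def)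
  qed auto
  then show ?thesis by simp
qed

lemma abs_cond_entropy_le:
  assumes "(0, 0) \<notin> V"
  shows "\<bar>cond_entropy V\<bar> \<le> lip"
proof -
  let ?f = "\<lambda>y \<omega>. cond_law V y \<omega> * ln (cond_law V y \<omega>)"
  have 1: "\<bar>expectation (?f y)\<bar> \<le> 2 / c0" for y
  proof -
    have "\<bar>expectation (?f y)\<bar> \<le> expectation (\<lambda>\<omega>. \<bar>?f y \<omega>\<bar>)" by (rule integral_abs_bound)
    also have "\<dots> \<le> expectation (\<lambda>\<omega>. 2 / c0)"
    proof (rule integral_mono_AE)
      show "AE \<omega> in P. \<bar>?f y \<omega>\<bar> \<le> 2 / c0"
        using cond_law_ge[OF assms] cond_law_le_1[of V]
        by eventually_elim (use abs_mult_ln_le[OF c0_pos] in auto)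
    qed (use integrable_cond_law_ln[OF assms] in auto)
    finally show ?thesis by simp
  qed
  have "\<bar>cond_entropy V\<bar> \<le> (\<Sum>y\<in>UNIV. \<bar>expectation (?f y)\<bar>)"
    unfolding cond_entropy_eq[OF assms] abs_minus_cancel by (rule sum_abs)
  also have "\<dots> \<le> (\<Sum>y\<in>(UNIV :: 'y set). 2 / c0)" by (intro sum_mono 1)
  also have "\<dots> = lip" by (simp add: lip_def)
  finally show ?thesis .
qed

lemma cond_entropy_window_diff:
  "\<bar>cond_entropy (line lam t {..-1}) - cond_entropy (window lam k t)\<bar> \<le> lip * gap lam k t"
proof -
  have w: "window lam k t \<subseteq> line lam t {..-1}" by (auto simp: window_def)
  have "\<bar>cond_entropy (line lam t {..-1}) - cond_entropy (window lam k t)\<bar>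
      \<le> lip * sqrt (collision (line lam t {..-1}) - collision (window lam k t))"
    by (rule cond_entropy_diff[OF w origin_notin_line]) simp
  also have "\<dots> \<le> lip * gap lam k t"
    by (intro mult_left_mono lip_nonneg collision_diff_le_gap w order_refl)
  finally show ?thesis .
qed

text \<open>A pointwise limit of step functions of \<open>t\<close>; this makes the limit integral
  accessible to the comparison with truncated entropies.\<close>

lemma cond_entropy_line_measurable: "(\<lambda>t. cond_entropy (line lam t {..-1})) \<in> borel_measurable borel"
proof (rule borel_measurable_LIMSEQ_real)
  show "(\<lambda>t. cond_entropy (window lam k t)) \<in> borel_measurable borel" for k
    by (rule window_function_measurable)
  show "(\<lambda>k. cond_entropy (window lam k t)) \<longlonglongrightarrow> cond_entropy (line lam t {..-1})" for t
  proof (rule LIM_zero_cancel, rule Lim_null_comparison)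
    show "(\<lambda>k. lip * gap lam k t) \<longlonglongrightarrow> 0"
      using tendsto_mult_right_zero[OF gap_tendsto_0] by simp
    show "\<forall>\<^sub>F k in sequentially. norm (cond_entropy (window lam k t) - cond_entropy (line lam t {..-1})) \<le> lip * gap lam k t"
      using cond_entropy_window_diff[of lam t] by (simp add: abs_minus_commute)
  qed
qed

lemma cond_entropy_integral_diff:
  "\<bar>(LBINT t:{0..1}. cond_entropy (window lam k t)) - (LBINT t:{0..1}. cond_entropy (line lam t {..-1}))\<bar>
    \<le> lip * (LBINT t:{0..1}. gap lam k t)"
proof -
  have i1: "set_integrable lborel {0..1} (\<lambda>t. cond_entropy (window lam k t))"
    by (intro set_integrable_unit_interval[where B = lip] window_function_measurable abs_cond_entropy_le origin_notin_window)
  have i2: "set_integrable lborel {0..1} (\<lambda>t. cond_entropy (line lam t {..-1}))"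
    by (rule set_integrable_unit_interval[OF cond_entropy_line_measurable abs_cond_entropy_le[OF origin_notin_line]]) simp
  have i3: "set_integrable lborel {0..1} (gap lam k)"
    using gap_bounds by (intro set_integrable_unit_interval[OF gap_measurable]) (simp add: abs_of_nonneg)
  have "(LBINT t:{0..1}. cond_entropy (window lam k t)) - (LBINT t:{0..1}. cond_entropy (line lam t {..-1}))
      = (LBINT t:{0..1}. cond_entropy (window lam k t) - cond_entropy (line lam t {..-1}))"
    using i1 i2 by simp
  also have "\<bar>\<dots>\<bar> \<le> (LBINT t:{0..1}. \<bar>cond_entropy (window lam k t) - cond_entropy (line lam t {..-1})\<bar>)"
    using set_integral_norm_bound[OF set_integral_diff(1)[OF i1 i2]] by simp
  also have "\<dots> \<le> (LBINT t:{0..1}. lip * gap lam k t)"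
  proof (rule set_integral_mono)
    show "set_integrable lborel {0..1} (\<lambda>t. \<bar>cond_entropy (window lam k t) - cond_entropy (line lam t {..-1})\<bar>)"
      using set_integral_diff(1)[OF i1 i2] by (rule set_integrable_abs)
    show "set_integrable lborel {0..1} (\<lambda>t. lip * gap lam k t)" using i3 by simp
  qed (use cond_entropy_window_diff[of lam _ k] in \<open>simp add: abs_minus_commute\<close>)
  also have "\<dots> = lip * (LBINT t:{0..1}. gap lam k t)" by simp
  finally show ?thesis .
qed

text \<open>The error has four parts: truncating the pasts along the orbit (\<open>A\<close>),
  fluctuation of the truncated gains about their means (\<open>D\<close>), the orbit average of
  truncated entropies against their integral (\<open>E\<close>), and truncation inside the
  integral.\<close>

lemma info_line_L1_convergence:
  assumes "lam \<notin> \<rat>"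
  shows "integrable P (\<lambda>\<omega>. info P (line lam a {0..int n}) \<omega> / real (n + 1))"
    and "(\<lambda>n. expectation (\<lambda>\<omega>. \<bar>info P (line lam a {0..int n}) \<omega> / real (n + 1)
       - (LBINT t:{0..1}. cond_entropy (line lam t {..-1}))\<bar>)) \<longlonglongrightarrow> 0"
proof -
  define s where "s i = frac (lam * real i + a)" for i :: nat
  define x where "x i = (int i, \<lfloor>lam * real i + a\<rfloor>)" for i :: nat
  define W where "W i = line lam (s i) {- int i..-1}" for i :: nat
  define I where "I = (LBINT t:{0..1}. cond_entropy (line lam t {..-1}))"
  have W: "finite (W i)" "(0, 0) \<notin> W i" for i
    unfolding W_def by (auto intro!: finite_line simp: origin_notin_line)
  have info: "info P (line lam a {0..int n}) \<omega> = (\<Sum>i\<le>n. info_gain (W i) (shift (x i) \<omega>))" for n \<omega>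
    unfolding info_line_decomposition W_def s_def x_def by simp
  have si: "integrable P (\<lambda>\<omega>. info_gain V (shift v \<omega>))" if "finite V" "(0, 0) \<notin> V" for V v
    by (rule integrable_bounded[OF measurable_compose[OF shift_measurable info_gain_measurable[OF that(1)]] abs_info_gain_le[OF that]])
  show int: "integrable P (\<lambda>\<omega>. info P (line lam a {0..int n}) \<omega> / real (n + 1))" for n
    unfolding info using si[OF W] by (intro integrable_divide Bochner_Integration.integrable_sum)
  define S where "S k i = window lam k (s i)" for k i
  have S: "finite (S k i)" "(0, 0) \<notin> S k i" "S k i \<subseteq> square k" for k i
    unfolding S_def using finite_window origin_notin_window by (auto simp: window_def)
  define C where "C = - ln c0"
  \<comment> \<open>The second summand pays for the first \<open>k\<close> indices, at which the
    past may still be too short to contain the window; two gains differ there by at most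
    \<open>2 * C\<close>.\<close>
  define A where "A k n = (\<Sum>i\<le>n. lip * gap lam k (s i)) / real (n + 1) + real k * (2 * C) / real (n + 1)" for k n
  define D where "D k n = expectation (\<lambda>\<omega>. \<bar>(\<Sum>i\<le>n. info_gain (S k i) (shift (x i) \<omega>) - cond_entropy (S k i)) / real (n + 1)\<bar>)" for k n
  define E where "E k n = \<bar>(\<Sum>i\<le>n. cond_entropy (S k i)) / real (n + 1) - (LBINT t:{0..1}. cond_entropy (window lam k t))\<bar>" for k n
  have C0: "0 \<le> C" unfolding C_def using abs_info_gain_le[OF W] order_trans[OF abs_ge_zero] by blast
  have diff: "expectation (\<lambda>\<omega>. \<bar>info_gain (W i) (shift (x i) \<omega>) - info_gain (S k i) (shift (x i) \<omega>)\<bar>)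
      \<le> lip * gap lam k (s i) + (if i < k then 2 * C else 0)" for i k
  proof -
    let ?f = "\<lambda>\<omega>. \<bar>info_gain (W i) \<omega> - info_gain (S k i) \<omega>\<bar>"
    have fm: "?f \<in> borel_measurable P"
      using info_gain_measurable[OF W(1)] info_gain_measurable[OF S(1)] by measurable
    have eq: "expectation (\<lambda>\<omega>. ?f (shift (x i) \<omega>)) = expectation ?f"
      by (rule expectation_shift[OF fm])
    show ?thesis
    proof (cases "i < k")
      case True
      have "expectation ?f \<le> expectation (\<lambda>\<omega>. 2 * C)"
      proof (rule integral_mono)
        show "?f \<omega> \<le> 2 * C" for \<omega>
          using abs_info_gain_le[OF W, of i \<omega>] abs_info_gain_le[OF S(1,2), of k i \<omega>] unfolding C_def by linarith
      qed (use info_gain_integrable[OF W] info_gain_integrable[OF S(1,2)] in auto)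
      then show ?thesis
        using True eq lip_nonneg gap_bounds(1)[of lam k "s i"] by (simp add: add_increasing)
    next
      case False
      have SW: "S k i \<subseteq> W i"
        using False by (auto simp: S_def W_def window_def mem_line_iff square_def)
      have WL: "W i \<subseteq> line lam (s i) {..-1}"
        unfolding W_def by (rule line_mono) auto
      have "expectation ?f \<le> lip * sqrt (collision (W i) - collision (S k i))"
        by (rule info_gain_diff[OF W(1) SW W(2)])
      also have "\<dots> \<le> lip * gap lam k (s i)"
        using SW WL unfolding S_def by (intro mult_left_mono lip_nonneg collision_diff_le_gap)
      finally show ?thesis using False eq by simp
    qed
  qed
  have bound: "expectation (\<lambda>\<omega>. \<bar>info P (line lam a {0..int n}) \<omega> / real (n + 1) - I\<bar>)
      \<le> A k n + D k n + E k n + lip * (LBINT t:{0..1}. gap lam k t)" for k n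
  proof -
    let ?R = "E k n + lip * (LBINT t:{0..1}. gap lam k t)"
    let ?a = "\<lambda>\<omega>. \<Sum>i\<le>n. \<bar>info_gain (W i) (shift (x i) \<omega>) - info_gain (S k i) (shift (x i) \<omega>)\<bar>"
    let ?d = "\<lambda>\<omega>. \<bar>(\<Sum>i\<le>n. info_gain (S k i) (shift (x i) \<omega>) - cond_entropy (S k i)) / real (n + 1)\<bar>"
    have ia: "integrable P ?a"
      using si[OF W] si[OF S(1,2)] by auto
    have id: "integrable P ?d"
      using si[OF S(1,2)] by (intro integrable_abs integrable_divide_zero Bochner_Integration.integrable_sum) auto
    have "expectation (\<lambda>\<omega>. \<bar>info P (line lam a {0..int n}) \<omega> / real (n + 1) - I\<bar>)
       \<le> expectation (\<lambda>\<omega>. ?a \<omega> / real (n + 1) + ?d \<omega> + ?R)"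
    proof (rule integral_mono)
      fix \<omega>
      let ?w = "\<lambda>i. info_gain (W i) (shift (x i) \<omega>)" and ?s = "\<lambda>i. info_gain (S k i) (shift (x i) \<omega>)"
      have "info P (line lam a {0..int n}) \<omega> / real (n + 1) - I
         = (\<Sum>i\<le>n. ?w i - ?s i) / real (n + 1) + (\<Sum>i\<le>n. ?s i - cond_entropy (S k i)) / real (n + 1)
           + ((\<Sum>i\<le>n. cond_entropy (S k i)) / real (n + 1) - (LBINT t:{0..1}. cond_entropy (window lam k t)))
           + ((LBINT t:{0..1}. cond_entropy (window lam k t)) - I)"
        unfolding info sum_subtractf diff_divide_distrib by simp
      moreover have "\<bar>(\<Sum>i\<le>n. ?w i - ?s i) / real (n + 1)\<bar> \<le> ?a \<omega> / real (n + 1)"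
        unfolding abs_divide by (simp add: divide_right_mono)
      moreover have "\<bar>(LBINT t:{0..1}. cond_entropy (window lam k t)) - I\<bar> \<le> lip * (LBINT t:{0..1}. gap lam k t)"
        unfolding I_def by (rule cond_entropy_integral_diff)
      ultimately show "\<bar>info P (line lam a {0..int n}) \<omega> / real (n + 1) - I\<bar> \<le> ?a \<omega> / real (n + 1) + ?d \<omega> + ?R"
        unfolding E_def by linarith
    qed (use int ia id in auto)
    also have "\<dots> = expectation ?a / real (n + 1) + D k n + ?R"
      using ia id by (simp add: D_def)
    also have "expectation ?a \<le> (\<Sum>i\<le>n. lip * gap lam k (s i)) + real k * (2 * C)"
    proof -
      have "expectation ?a = (\<Sum>i\<le>n. expectation (\<lambda>\<omega>. \<bar>info_gain (W i) (shift (x i) \<omega>) - info_gain (S k i) (shift (x i) \<omega>)\<bar>))"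
        using si[OF W] si[OF S(1,2)] by (intro Bochner_Integration.integral_sum) auto
      also have "\<dots> \<le> (\<Sum>i\<le>n. lip * gap lam k (s i) + (if i < k then 2 * C else 0))"
        by (intro sum_mono diff)
      also have "\<dots> = (\<Sum>i\<le>n. lip * gap lam k (s i)) + (\<Sum>i\<in>{..n} \<inter> {..<k}. 2 * C)"
        by (simp only: sum.distrib sum.inter_restrict[OF finite_atMost] lessThan_iff)
      also have "(\<Sum>i\<in>{..n} \<inter> {..<k}. 2 * C) \<le> (\<Sum>i<k. 2 * C)"
        using C0 by (intro sum_mono2) auto
      finally show ?thesis by simp
    qed
    finally show ?thesis
      by (simp add: A_def add_divide_distrib[symmetric] divide_right_mono)
  qed
  define G where "G k = (LBINT t:{0..1}. gap lam k t)" for k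
  have A: "A k \<longlonglongrightarrow> lip * G k + 0" for k
    unfolding A_def
  proof (rule tendsto_add)
    have "(\<lambda>n. (\<Sum>i\<le>n. gap lam k (s i)) / real (n + 1)) \<longlonglongrightarrow> G k"
      unfolding G_def gap_def s_def
      by (rule equidistributed_window[OF assms, where F = "\<lambda>S. sqrt (collision (S \<union> (UNIV - square k)) - collision S)"])
    from tendsto_mult[OF tendsto_const[of lip] this]
    show "(\<lambda>n. (\<Sum>i\<le>n. lip * gap lam k (s i)) / real (n + 1)) \<longlonglongrightarrow> lip * G k"
      by (simp only: sum_distrib_left[symmetric] times_divide_eq_right)
    show "(\<lambda>n. real k * (2 * C) / real (n + 1)) \<longlonglongrightarrow> 0"
      using LIMSEQ_Suc[OF lim_const_over_n[of "real k * (2 * C)"]] by simp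
  qed
  have D: "D k \<longlonglongrightarrow> 0" for k
    unfolding D_def by (rule average_info_gain_tendsto[OF S(3,2)]) (simp add: x_def)
  have E: "E k \<longlonglongrightarrow> 0" for k
  proof -
    have "(\<lambda>n. (\<Sum>i\<le>n. cond_entropy (S k i)) / real (n + 1)) \<longlonglongrightarrow> (LBINT t:{0..1}. cond_entropy (window lam k t))"
      unfolding S_def s_def by (rule equidistributed_window[OF assms])
    then show ?thesis unfolding E_def by (simp add: LIM_zero tendsto_rabs_zero)
  qed
  have "(\<lambda>n. expectation (\<lambda>\<omega>. \<bar>info P (line lam a {0..int n}) \<omega> / real (n + 1) - I\<bar>)) \<longlonglongrightarrow> 0"
  proof (rule tendsto_0_of_bounds)
    show "expectation (\<lambda>\<omega>. \<bar>info P (line lam a {0..int n}) \<omega> / real (n + 1) - I\<bar>) \<le> A k n + D k n + E k n + lip * G k" for k n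
      unfolding G_def by (rule bound)
    \<comment> \<open>The integrated gap enters twice: through truncation along the orbit and
      through truncation inside the integral.\<close>
    show "(\<lambda>n. A k n + D k n + E k n + lip * G k) \<longlonglongrightarrow> (lip * G k + 0) + 0 + 0 + lip * G k" for k
      by (intro tendsto_add A D E tendsto_const)
    have "(\<lambda>k. (lip * G k + 0) + 0 + 0 + lip * G k) \<longlonglongrightarrow> (lip * 0 + 0) + 0 + 0 + lip * 0"
      unfolding G_def by (intro tendsto_add tendsto_mult tendsto_const gap_integral_tendsto_0)
    then show "(\<lambda>k. (lip * G k + 0) + 0 + 0 + lip * G k) \<longlonglongrightarrow> 0" by simp
  qed simp
  then show "(\<lambda>n. expectation (\<lambda>\<omega>. \<bar>info P (line lam a {0..int n}) \<omega> / real (n + 1)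
       - (LBINT t:{0..1}. cond_entropy (line lam t {..-1}))\<bar>)) \<longlonglongrightarrow> 0"
    unfolding I_def .
qed

end

theorem theorem3p2:
  fixes P :: "('y::finite) config measure" and lam a :: real
  assumes "lam \<notin> \<rat>"
    and "prob_space P" and "sets P = sets config_space"
    and "stationary P" and "condition_B P" and "strong_01_law P"
  shows "(\<forall>n::nat. integrable P (\<lambda>\<omega>. info P (line lam a {0..int n}) \<omega> / real (n + 1)))
    \<and> (\<lambda>n::nat. \<integral>\<omega>. \<bar>info P (line lam a {0..int n}) \<omega> / real (n + 1)
           - (LBINT t:{0..1}. \<integral>\<eta>. entropy_fn (cond_law0 P (past P lam t) \<eta>) \<partial>P)\<bar> \<partial>P)
      \<longlonglongrightarrow> 0"
proof -
  obtain c0 where c0: "0 < c0" "\<forall>y A. A \<in> sets (sigF P (UNIV - {(0, 0)})) \<and> 0 < measure P A \<longrightarrow>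
      c0 < measure P ({\<omega> \<in> space P. \<omega> (0, 0) = y} \<inter> A) / measure P A"
    using assms(5) unfolding condition_B_def by (elim exE conjE)
  have axioms: "random_field_axioms P c0"
    by (rule random_field_axioms.intro[OF assms(3,4) c0(1) c0(2)[rule_format, OF conjI] assms(6)])
  interpret random_field P c0
    by (rule random_field.intro[OF assms(2) axioms])
  show ?thesis
    using info_line_L1_convergence[OF assms(1)] unfolding cond_entropy_def past_def by simp
qed

end
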